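(* Let $n=n_d\ge1$, $\alpha=\alpha_d>0$, $1\le s=s_d\le d$, $a=a_d>0$ depend on $d$. Assume that, as $d\to\infty$, $\alpha/d\to0$, $n\alpha^2/d\to+\infty$ and $\sigma\sqrt d/(\alpha\sqrt n)\ll a\le2\sigma$. Let $\hat\eta^+$ be the selector with components $\hat\eta^+_j=I\bigl(\frac1n\sum_{i=1}^nZ^i_j\ge\tau\bigr)$, $j=1,\dots,d$, with $\tau=p(2)a/\sigma$. Then for $n,d$ large enough $$\sup_{\theta\in\Theta_d^+(s,a)}\frac1s\mathbb{E}|\hat\eta^+-\eta|\le\frac ds\exp\Bigl(-\frac{n(e^\alpha-1)^2p^2(2)a^2}{2\sigma^2(e^\alpha+1)^2K_d^2}\Bigr).$$ In particular, if $\alpha\in(0,1]$ and $n\alpha^2/d\to+\infty$ with $n\alpha^2/d\gg\log(d)$, then $$\sup_{\theta\in\Theta_d^+(s,a)}\frac1s\mathbb{E}|\hat\eta^+-\eta|\to0\quad\text{for all } a \text{ satisfying }\ \sigma\sqrt{\frac{d}{n\alpha^2}}\sqrt{\log(d/s)}\ll a\le2\sigma,$$ and also $$\sup_{\theta\in\Theta_d^+(s,a)}\mathbb{E}|\hat\eta^+-\eta|\to0\quad\text{for all } a \text{ satisfying }\ \sigma\sqrt{\frac{d}{n\alpha^2}}\sqrt{\log(d)}\ll a\le2\sigma .$$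
   Context: Notation: $a_d\gg b_d$ (equivalently $b_d\ll a_d$) means $a_d/b_d\to\infty$ as $d\to\infty$. Model: $\sigma>0$, $\theta\in\mathbb{R}^d$; $X^1,\dots,X^n$ are i.i.d. random vectors in $\mathbb{R}^d$, $X^i=\theta+\sigma\xi^i$, where $\xi^i$ has i.i.d. coordinates whose common law on $\mathbb{R}$ (not depending on $d$) is symmetric around $0$, has variance $1$ and is $c$-strongly log-concave for a constant $c>0$: it has density $p(x)=\exp(-\phi_0(x))\exp(-cx^2/2)$ with $\phi_0:\mathbb{R}\to\mathbb{R}$ a finite even convex function. $p(2)$ is the value of this density at $2$. $\Theta_d^+(s,a)$ is the set of $\theta\in\mathbb{R}^d$ for which there is $S\subseteq\{1,\dots,d\}$ with at most $s$ elements such that $\theta_j\ge a$ for $j\in S$ and $\theta_j=0$ for $j\notin S$. Put $\eta=(I(\theta_j\ne0))_{j=1,\dots,d}$ and $|\hat\eta-\eta|=\sum_{j=1}^d I(\hat\eta_j\neq\eta_j)$. Privatized data (coordinate global mechanism, $d\ge3$). Let $\mathrm{sgn}[x]=1$ for $x\ge0$, $-1$ for $x<0$, and $\tilde X^i=(\mathrm{sgn}[X^i_j])_{j=1,\dots,d}$. Let $$B=\frac{e^\alpha+1}{e^\alpha-1}K_d,\qquad \frac1{K_d}=\begin{cases}\frac1{2^{d-1}}\binom{d-1}{\frac{d-1}2}& d\text{ odd},\\[2pt] \frac{(d-2)!\,(d-2)}{2^{d-1}(\frac d2-1)!\,\frac d2!}& d\text{ even}.\end{cases}$$ Independently for each $i$: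 draw $Y^i\sim\mathrm{Bernoulli}(\pi_\alpha)$, $\pi_\alpha=e^\alpha/(e^\alpha+1)$, independent of $X^i$. If $Y^i=1$, draw $\tilde Z^i$ uniformly on $\{\tilde z\in\{-B,B\}^d:\langle\tilde z,\tilde X^i\rangle>0\text{ or }(\langle\tilde z,\tilde X^i\rangle=0\text{ and }\tilde z_1=B\tilde X^i_1)\}$; if $Y^i=0$, draw $\tilde Z^i$ uniformly on $\{\tilde z\in\{-B,B\}^d:\langle\tilde z,\tilde X^i\rangle<0\text{ or }(\langle\tilde z,\tilde X^i\rangle=0\text{ and }\tilde z_1=-B\tilde X^i_1)\}$. If $d$ is odd, $Z^i=\tilde Z^i$; if $d$ is even, $Z^i_1=\frac{d-2}{2(d-1)}\tilde Z^i_1$ and $Z^i_j=\tilde Z^i_j$ for $2\le j\le d$.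
   Formalization: In the first limit claim the assumption σ√d/(α√n) ≪ a is kept alongside the displayed range of a; without it the claim fails when d/s → 1, e.g. α=1, n=d³, s=d−1, a=σ√(log d/n), where the risk at θ=0 tends to 1/2. *)

theory Defs
  imports "HOL-Probability.Probability"
begin

text \<open>
  A vector in \<open>\<real>\<^sup>d\<close> is a function \<open>nat \<Rightarrow> real\<close> that is extensional on the index set \<open>{1..d}\<close>.
\<close>

text \<open>
  The quotient is formed in the extended reals, so that \<open>a\<^sub>d / 0 = \<infinity>\<close> for \<open>a\<^sub>d > 0\<close>. This matters
  for the rate \<open>sqrt (ln (d / s\<^sub>d))\<close>, which vanishes when \<open>s\<^sub>d = d\<close>.
\<close>

definition much_less :: "(nat \<Rightarrow> real) \<Rightarrow> (nat \<Rightarrow> real) \<Rightarrow> bool" (infix \<open>\<lless>\<close> 50)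
  where "b \<lless> a \<longleftrightarrow> ((\<lambda>d. ereal (a d) / ereal (b d)) \<longlonglongrightarrow> \<infinity>)"

text \<open>Evenness of \<open>\<phi>\<^sub>0\<close> makes the law with density \<open>p\<close> symmetric around \<open>0\<close>.\<close>

definition symmetric_strongly_log_concave :: "real \<Rightarrow> (real \<Rightarrow> real) \<Rightarrow> bool"
  where "symmetric_strongly_log_concave c p \<longleftrightarrow> c > 0 \<and>
    (\<exists>\<phi>\<^sub>0. convex_on UNIV \<phi>\<^sub>0 \<and> (\<forall>x. \<phi>\<^sub>0 (- x) = \<phi>\<^sub>0 x) \<and>
      (\<forall>x. p x = exp (- \<phi>\<^sub>0 x) * exp (- c * x\<^sup>2 / 2)))"

definition noise_law :: "(real \<Rightarrow> real) \<Rightarrow> real measure"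
  where "noise_law p = density lborel (\<lambda>x. ennreal (p x))"

definition observation_law :: "(real \<Rightarrow> real) \<Rightarrow> real \<Rightarrow> nat \<Rightarrow> (nat \<Rightarrow> real) \<Rightarrow> (nat \<Rightarrow> real) measure"
  where "observation_law p \<sigma> d \<theta> =
    distr (\<Pi>\<^sub>M j\<in>{1..d}. noise_law p) (\<Pi>\<^sub>M j\<in>{1..d}. borel) (\<lambda>\<xi>. \<lambda>j\<in>{1..d}. \<theta> j + \<sigma> * \<xi> j)"

definition Theta_plus :: "nat \<Rightarrow> nat \<Rightarrow> real \<Rightarrow> (nat \<Rightarrow> real) set"
  where "Theta_plus d s a = {\<theta> \<in> {1..d} \<rightarrow>\<^sub>E UNIV.
    \<exists>S \<subseteq> {1..d}. card S \<le> s \<and> (\<forall>j\<in>S. \<theta> j \<ge> a) \<and> (\<forall>j\<in>{1..d} - S. \<theta> j = 0)}"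

text \<open>Unlike \<^const>\<open>sgn\<close>, this sign takes the value \<open>1\<close> at \<open>0\<close>.\<close>

definition sgn1 :: "real \<Rightarrow> real"
  where "sgn1 x = (if x \<ge> 0 then 1 else -1)"

definition K :: "nat \<Rightarrow> real"
  where "K d = inverse
    (if odd d then real ((d - 1) choose ((d - 1) div 2)) / 2 ^ (d - 1)
     else fact (d - 2) * real (d - 2) / (2 ^ (d - 1) * fact (d div 2 - 1) * fact (d div 2)))"

definition B :: "real \<Rightarrow> nat \<Rightarrow> real"
  where "B \<alpha> d = (exp \<alpha> + 1) / (exp \<alpha> - 1) * K d"

definition inner_vec :: "nat \<Rightarrow> (nat \<Rightarrow> real) \<Rightarrow> (nat \<Rightarrow> real) \<Rightarrow> real"
  where "inner_vec d z x = (\<Sum>j=1..d. z j * x j)"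

definition agree_set :: "real \<Rightarrow> nat \<Rightarrow> (nat \<Rightarrow> real) \<Rightarrow> (nat \<Rightarrow> real) set"
  where "agree_set b d x = {z \<in> {1..d} \<rightarrow>\<^sub>E {- b, b}.
    inner_vec d z x > 0 \<or> (inner_vec d z x = 0 \<and> z 1 = b * x 1)}"

definition disagree_set :: "real \<Rightarrow> nat \<Rightarrow> (nat \<Rightarrow> real) \<Rightarrow> (nat \<Rightarrow> real) set"
  where "disagree_set b d x = {z \<in> {1..d} \<rightarrow>\<^sub>E {- b, b}.
    inner_vec d z x < 0 \<or> (inner_vec d z x = 0 \<and> z 1 = - b * x 1)}"

definition rescale :: "nat \<Rightarrow> (nat \<Rightarrow> real) \<Rightarrow> (nat \<Rightarrow> real)"
  where "rescale d z =
    (if odd d then z else z(1 := (real d - 2) / (2 * (real d - 1)) * z 1))"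

text \<open>The conditional law of \<open>Z\<^sup>i\<close> given the sign vector \<open>x\<close> of \<open>X\<^sup>i\<close>; the Bernoulli draw \<open>y\<close> is \<open>Y\<^sup>i\<close>.\<close>

definition privatize :: "real \<Rightarrow> nat \<Rightarrow> (nat \<Rightarrow> real) \<Rightarrow> (nat \<Rightarrow> real) pmf"
  where "privatize \<alpha> d x =
    bind_pmf (bernoulli_pmf (exp \<alpha> / (exp \<alpha> + 1))) (\<lambda>y.
      map_pmf (rescale d)
        (pmf_of_set (if y then agree_set (B \<alpha> d) d x else disagree_set (B \<alpha> d) d x)))"

definition private_law ::
    "(real \<Rightarrow> real) \<Rightarrow> real \<Rightarrow> real \<Rightarrow> nat \<Rightarrow> (nat \<Rightarrow> real) \<Rightarrow> (nat \<Rightarrow> real) measure"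
  where "private_law p \<sigma> \<alpha> d \<theta> =
    observation_law p \<sigma> d \<theta> \<bind>
      (\<lambda>x. measure_pmf (privatize \<alpha> d (\<lambda>j\<in>{1..d}. sgn1 (x j))))"

definition sample_law ::
    "(real \<Rightarrow> real) \<Rightarrow> real \<Rightarrow> real \<Rightarrow> nat \<Rightarrow> nat \<Rightarrow> (nat \<Rightarrow> real) \<Rightarrow> (nat \<Rightarrow> nat \<Rightarrow> real) measure"
  where "sample_law p \<sigma> \<alpha> n d \<theta> = (\<Pi>\<^sub>M i\<in>{1..n}. private_law p \<sigma> \<alpha> d \<theta>)"

definition support_ind :: "(nat \<Rightarrow> real) \<Rightarrow> nat \<Rightarrow> nat"
  where "support_ind \<theta> j = of_bool (\<theta> j \<noteq> 0)"

definition selector :: "real \<Rightarrow> nat \<Rightarrow> (nat \<Rightarrow> nat \<Rightarrow> real) \<Rightarrow> nat \<Rightarrow> nat"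
  where "selector \<tau> n Z j = of_bool (1 / real n * (\<Sum>i=1..n. Z i j) \<ge> \<tau>)"

definition hamming :: "nat \<Rightarrow> (nat \<Rightarrow> nat) \<Rightarrow> (nat \<Rightarrow> nat) \<Rightarrow> real"
  where "hamming d \<eta> \<eta>' = (\<Sum>j=1..d. of_bool (\<eta> j \<noteq> \<eta>' j))"

definition expected_hamming ::
    "(real \<Rightarrow> real) \<Rightarrow> real \<Rightarrow> real \<Rightarrow> nat \<Rightarrow> nat \<Rightarrow> real \<Rightarrow> (nat \<Rightarrow> real) \<Rightarrow> real"
  where "expected_hamming p \<sigma> \<alpha> n d \<tau> \<theta> =
    (\<integral>Z. hamming d (selector \<tau> n Z) (support_ind \<theta>) \<partial>(sample_law p \<sigma> \<alpha> n d \<theta>))"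

end

theory Submission
  imports Defs
begin

text \<open>
  A sign vector \<open>z\<close> with entries \<open>\<plusminus> B\<close> lies in the agreement set of \<open>x\<close> iff the coordinates where
  \<open>z\<^sub>j = B x\<^sub>j\<close> form a majority, and the normalisation \<open>K\<^sub>d\<close> is the inverse of the influence of a single
  coordinate on a majority vote. Hence \<open>Z\<^sub>j\<close> is bounded by \<open>B\<close> and is conditionally unbiased for the sign
  of \<open>X\<^sub>j\<close>. By symmetry of the noise, \<open>E sgn X\<^sub>j = P(\<bar>\<sigma>\<xi>\<^sub>j\<bar> \<le> \<theta>\<^sub>j)\<close>, which is \<open>0\<close> if \<open>\<theta>\<^sub>j = 0\<close> and, as the
  density is at least \<open>p(2)\<close> on \<open>[-2, 2]\<close>, at least \<open>2\<tau>\<close> if \<open>\<theta>\<^sub>j \<ge> a\<close>. So an error in a coordinate is a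
  deviation of the empirical mean by at least \<open>\<tau>\<close>, to which Hoeffding's inequality applies; a union over the
  coordinates gives the bound. The limits follow from \<open>K\<^sub>d\<^sup>2 \<le> 8d\<close>.
\<close>

section \<open>Influence of one coordinate on a majority vote\<close>

text \<open>Sets of \<open>F\<close> without \<open>j\<close> pair off with
  \<open>insert j A\<close>, which stays in \<open>F\<close>, and the two signs cancel. What
  survives are the sets that contain \<open>j\<close> and leave \<open>F\<close> when
  \<open>j\<close> is removed.\<close>

lemma sum_signs_upward_closed:
  assumes "finite U" "j \<in> U" "F \<subseteq> Pow U"
    and up: "\<And>A. A \<in> F \<Longrightarrow> insert j A \<in> F"
  shows "(\<Sum>A\<in>F. if j \<in> A then 1 else - 1 :: real) = real (card {A \<in> F. j \<in> A \<and> A - {j} \<notin> F})"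
proof -
  let ?W = "{A \<in> F. j \<in> A}" and ?O = "{A \<in> F. j \<notin> A}"
    and ?P = "{A \<in> F. j \<in> A \<and> A - {j} \<notin> F}" and ?R = "{A \<in> F. j \<in> A \<and> A - {j} \<in> F}"
  have fin: "finite F"
    using assms by (meson finite_Pow_iff finite_subset)
  have "bij_betw (insert j) ?O ?R"
    by (rule bij_betw_byWitness[where f' = "\<lambda>A. A - {j}"]) (auto simp: up insert_absorb)
  then have "card ?O = card ?R"
    by (rule bij_betw_same_card)
  moreover have "card ?W = card ?P + card ?R"
    using fin by (subst card_Un_disjoint[symmetric]) (auto intro!: arg_cong[where f = card])
  moreover have "(\<Sum>A\<in>F. if j \<in> A then 1 else - 1 :: real) = real (card ?W) - real (card ?O)"
    using fin by (simp add: sum.If_cases Int_def)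
  ultimately show ?thesis
    by simp
qed

lemma card_subsets_containing:
  assumes "finite U" "j \<in> U"
  shows "card {A. A \<subseteq> U \<and> j \<in> A \<and> card A = Suc k} = (card U - 1) choose k"
proof -
  have "bij_betw (insert j) {A. A \<subseteq> U - {j} \<and> card A = k} {A. A \<subseteq> U \<and> j \<in> A \<and> card A = Suc k}"
  proof (rule bij_betw_byWitness[where f' = "\<lambda>A. A - {j}"])
    show "insert j ` {A. A \<subseteq> U - {j} \<and> card A = k} \<subseteq> {A. A \<subseteq> U \<and> j \<in> A \<and> card A = Suc k}"
    proof clarify
      fix A assume A: "A \<subseteq> U - {j}"
      then have "finite A" "j \<notin> A"
        using assms finite_subset by auto
      then show "insert j A \<subseteq> U \<and> j \<in> insert j A \<and> card (insert j A) = Suc (card A)"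
        using A assms by auto
    qed
    show "(\<lambda>A. A - {j}) ` {A. A \<subseteq> U \<and> j \<in> A \<and> card A = Suc k} \<subseteq> {A. A \<subseteq> U - {j} \<and> card A = k}"
      by (auto simp: card_Diff_singleton)
  qed auto
  then have "card {A. A \<subseteq> U - {j} \<and> card A = k} = card {A. A \<subseteq> U \<and> j \<in> A \<and> card A = Suc k}"
    by (rule bij_betw_same_card)
  then show ?thesis
    using assms n_subsets[of "U - {j}" k] by simp
qed

text \<open>The strict majorities, with ties for even \<open>d\<close> broken by coordinate \<open>1\<close> as in \<^const>\<open>agree_set\<close>.\<close>

definition majority :: "nat \<Rightarrow> nat set set"
  where "majority d = {A. A \<subseteq> {1..d} \<and> (d < 2 * card A \<or> d = 2 * card A \<and> 1 \<in> A)}"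

text \<open>The winning coalitions in which the vote of \<open>j\<close> is decisive. Their number
  divided by \<open>2 ^ (d - 1)\<close> is the Banzhaf influence of \<open>j\<close> in the majority
  game.\<close>

definition pivotal :: "nat \<Rightarrow> nat \<Rightarrow> nat set set"
  where "pivotal d j = {A \<in> majority d. j \<in> A \<and> A - {j} \<notin> majority d}"

lemma finite_majority: "finite (majority d)"
  unfolding majority_def by simp

lemma sum_signs_majority:
  assumes "j \<in> {1..d}"
  shows "(\<Sum>A\<in>majority d. if j \<in> A then 1 else - 1 :: real) = real (card (pivotal d j))"
  unfolding pivotal_def
proof (rule sum_signs_upward_closed[of "{1..d}"])
  fix A assume A: "A \<in> majority d"
  then have "finite A"
    unfolding majority_def using finite_subset by blast
  then have "card A \<le> card (insert j A)"
    by (intro card_mono) auto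
  with A assms show "insert j A \<in> majority d"
    by (auto simp: majority_def)
next
  show "majority d \<subseteq> Pow {1..d}"
    unfolding majority_def by blast
qed (use assms in simp_all)

text \<open>Complementation exchanges winning and losing coalitions: of a set and its complement the
  larger wins, and in a tie exactly one of them contains \<open>1\<close>. So half of all subsets
  win.\<close>

lemma card_majority:
  assumes "d \<ge> 1"
  shows "card (majority d) = 2 ^ (d - 1)"
proof -
  let ?U = "{1..d}"
  have card_compl: "card (?U - A) = d - card A" "card A \<le> d" if "A \<subseteq> ?U" for A
    using that finite_subset[OF that] card_mono[OF _ that] by (auto simp: card_Diff_subset)
  have "bij_betw (\<lambda>A. ?U - A) (majority d) (Pow ?U - majority d)"
  proof (rule bij_betw_byWitness[where f' = "\<lambda>A. ?U - A"])
    show "(\<lambda>A. ?U - A) ` majority d \<subseteq> Pow ?U - majority d"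
      using card_compl by (fastforce simp: majority_def)
    show "(\<lambda>A. ?U - A) ` (Pow ?U - majority d) \<subseteq> majority d"
    proof clarify
      fix A assume "A \<subseteq> ?U" "A \<notin> majority d"
      then show "?U - A \<in> majority d"
        using card_compl[of A] assms by (auto simp: majority_def)
    qed
  qed (auto simp: majority_def)
  then have "card (majority d) = card (Pow ?U - majority d)"
    by (rule bij_betw_same_card)
  also have "\<dots> = 2 ^ d - card (majority d)"
    by (subst card_Diff_subset) (auto simp: finite_majority majority_def card_Pow)
  finally have *: "card (majority d) = 2 ^ d - card (majority d)" .
  have "2 ^ d = 2 * (2 ^ (d - 1) :: nat)"
    using assms by (cases d) auto
  with * show ?thesis
    by linarith
qed

lemma card_minus_one:
  assumes "A \<subseteq> {1..d :: nat}" "j \<in> A"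
  shows "card A = Suc (card (A - {j}))"
  by (rule card.remove[OF finite_subset[OF assms(1) finite_atLeastAtMost] assms(2)])

text \<open>Without ties, \<open>j\<close> is decisive exactly when the remaining
  \<open>2 * m\<close> voters split evenly.\<close>

lemma card_pivotal_odd:
  assumes "j \<in> {1..2 * m + 1}"
  shows "card (pivotal (2 * m + 1) j) = (2 * m) choose m"
proof -
  have "pivotal (2 * m + 1) j = {A. A \<subseteq> {1..2 * m + 1} \<and> j \<in> A \<and> card A = Suc m}"
  proof (rule set_eqI)
    fix A
    show "A \<in> pivotal (2 * m + 1) j \<longleftrightarrow> A \<in> {A. A \<subseteq> {1..2 * m + 1} \<and> j \<in> A \<and> card A = Suc m}"
    proof (cases "A \<subseteq> {1..2 * m + 1} \<and> j \<in> A")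
      case True
      then have "A - {j} \<subseteq> {1..2 * m + 1}"
        by auto
      moreover have "2 * m + 1 \<noteq> 2 * l" for l
        by presburger
      ultimately show ?thesis
        using True card_minus_one[of A "2 * m + 1" j] unfolding pivotal_def majority_def
        by (simp only: mem_Collect_eq) arith
    qed (auto simp: pivotal_def majority_def)
  qed
  then show ?thesis
    using assms by (simp add: card_subsets_containing)
qed

text \<open>Coordinate \<open>1\<close> also breaks ties, so it is decisive in the coalitions of
  size \<open>m\<close> (a tie that it wins) and of size \<open>m + 1\<close> (which become a tie
  that is lost without it). Pascal's rule adds the two counts.\<close>

lemma card_pivotal_even_1:
  assumes "m \<ge> 1"
  shows "card (pivotal (2 * m) 1) = (2 * m) choose m"
proof -
  obtain k where m: "m = Suc k"
    using assms by (cases m) auto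
  let ?S = "\<lambda>k. {A. A \<subseteq> {1..2 * m} \<and> 1 \<in> A \<and> card A = Suc k}"
  have "pivotal (2 * m) 1 = ?S k \<union> ?S m"
  proof (rule set_eqI)
    fix A
    show "A \<in> pivotal (2 * m) 1 \<longleftrightarrow> A \<in> ?S k \<union> ?S m"
      using card_minus_one[of A "2 * m" 1] unfolding pivotal_def majority_def m
      by (cases "A \<subseteq> {1..2 * Suc k} \<and> 1 \<in> A") auto
  qed
  moreover have "finite (?S i)" for i
    by (rule finite_subset[of _ "Pow {1..2 * m}"]) auto
  moreover have "?S k \<inter> ?S m = {}"
    using m by auto
  ultimately have "card (pivotal (2 * m) 1) = ((2 * m - 1) choose k) + ((2 * m - 1) choose m)"
    using assms by (simp add: card_Un_disjoint card_subsets_containing)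
  also have "\<dots> = (2 * m) choose m"
    using m by simp
  finally show ?thesis .
qed

text \<open>A coordinate other than \<open>1\<close> is decisive in two ways: in a tie that contains
  \<open>1\<close>, or in a coalition of size \<open>m + 1\<close> without \<open>1\<close>. The two
  counts are \<open>(2 * m - 2) choose (m - 2)\<close> and \<open>(2 * m - 2) choose m\<close>,
  which agree by symmetry of the binomial coefficients.\<close>

lemma card_pivotal_even:
  assumes "m \<ge> 2" "j \<in> {2..2 * m}"
  shows "card (pivotal (2 * m) j) = 2 * ((2 * m - 2) choose m)"
proof -
  obtain k where m: "m = k + 2"
    using assms by (metis add.commute le_Suc_ex)
  \<comment> \<open>Both kinds of coalition are counted inside \<open>V\<close>, the voters other
    than the tie-breaker; those of the first kind are recovered from \<open>V\<close> by inserting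
    \<open>1\<close>.\<close>
  define V where "V = {1..2 * m} - {1}"
  have V: "finite V" "card V = 2 * m - 1" "j \<in> V"
    using assms by (auto simp: V_def)
  let ?S = "{A. A \<subseteq> V \<and> j \<in> A \<and> card A = Suc m}"
    and ?T = "{A. A \<subseteq> V \<and> j \<in> A \<and> card A = Suc k}"
  have sub: "A \<subseteq> V \<longleftrightarrow> A \<subseteq> {1..2 * m} \<and> 1 \<notin> A" for A
    unfolding V_def by blast
  have T: "A \<in> insert 1 ` ?T \<longleftrightarrow> A \<subseteq> {1..2 * m} \<and> 1 \<in> A \<and> j \<in> A \<and> card A = m" for A
  proof
    assume "A \<in> insert 1 ` ?T"
    then obtain C where C: "C \<subseteq> V" "j \<in> C" "card C = Suc k" "A = insert 1 C"
      by blast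
    then have "finite C" "1 \<notin> C"
      using V sub finite_subset by blast+
    with C m show "A \<subseteq> {1..2 * m} \<and> 1 \<in> A \<and> j \<in> A \<and> card A = m"
      unfolding V_def by auto
  next
    assume A: "A \<subseteq> {1..2 * m} \<and> 1 \<in> A \<and> j \<in> A \<and> card A = m"
    then have "card A = Suc (card (A - {1}))"
      by (intro card_minus_one) auto
    with A m have "card (A - {1}) = Suc k"
      by linarith
    moreover have "A - {1} \<subseteq> V" and ins: "A = insert 1 (A - {1})"
      using A unfolding V_def by blast+
    moreover have "j \<in> A - {1}"
      using A assms by simp
    ultimately have "A - {1} \<in> ?T"
      by blast
    with ins show "A \<in> insert 1 ` ?T"
      by (rule image_eqI)
  qed
  have "pivotal (2 * m) j = ?S \<union> insert 1 ` ?T"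
  proof (rule set_eqI)
    fix A
    show "A \<in> pivotal (2 * m) j \<longleftrightarrow> A \<in> ?S \<union> insert 1 ` ?T"
    proof (cases "A \<subseteq> {1..2 * m} \<and> j \<in> A")
      case True
      then have c: "card A = Suc (card (A - {j}))"
        by (intro card_minus_one) auto
      have "A - {j} \<subseteq> {1..2 * m}" "1 \<in> A - {j} \<longleftrightarrow> 1 \<in> A"
        using True assms by auto
      then have "A \<in> pivotal (2 * m) j \<longleftrightarrow> (1 \<in> A \<and> card A = m) \<or> (1 \<notin> A \<and> card A = Suc m)"
        using True c unfolding pivotal_def majority_def
        by (cases "1 \<in> A") (simp_all only: mem_Collect_eq, arith+)
      then show ?thesis
        unfolding Un_iff T unfolding mem_Collect_eq sub using True by argo
    next
      case False
      then show ?thesis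
        unfolding Un_iff T unfolding mem_Collect_eq sub pivotal_def majority_def by argo
    qed
  qed
  moreover have "finite ?S" "finite ?T"
    using V(1) by simp_all
  moreover have "?S \<inter> insert 1 ` ?T = {}"
    using sub by blast
  moreover have "inj_on (insert 1) ?T"
    unfolding inj_on_def using sub by (metis (mono_tags, lifting) insert_ident mem_Collect_eq)
  ultimately have "card (pivotal (2 * m) j) = card ?S + card ?T"
    by (simp add: card_Un_disjoint card_image)
  also have "\<dots> = ((2 * m - 2) choose m) + ((2 * m - 2) choose k)"
    using V by (simp add: card_subsets_containing numeral_2_eq_2)
  also have "(2 * m - 2) choose k = (2 * m - 2) choose m"
    using m by (subst binomial_symmetric) auto
  finally show ?thesis
    by simp
qed

section \<open>The normalisation as an inverse influence\<close>

text \<open>For even \<open>d\<close> tie-breaking gives coordinate \<open>1\<close> more influence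
  than the others have; this factor compensates for it.\<close>

definition rescale_factor :: "nat \<Rightarrow> nat \<Rightarrow> real"
  where "rescale_factor d j = (if even d \<and> j = 1 then (real d - 2) / (2 * (real d - 1)) else 1)"

lemma rescale_eq: "rescale d z j = rescale_factor d j * z j"
  by (simp add: rescale_def rescale_factor_def)

lemma rescale_factor_bounds:
  assumes "d \<ge> 3"
  shows "0 \<le> rescale_factor d j" "rescale_factor d j \<le> 1"
  using assms by (simp_all add: rescale_factor_def divide_le_eq)

lemma K_odd: "K (2 * m + 1) = 2 ^ (2 * m) / real ((2 * m) choose m)"
  by (simp add: K_def field_simps)

text \<open>With \<open>d = 2 * m\<close>, the factor \<open>d - 2\<close> is
  \<open>2 * (m - 1)\<close>: its \<open>2\<close> cancels one power of two and its
  \<open>m - 1\<close> reduces \<open>fact (m - 1)\<close> to \<open>fact (m - 2)\<close>, which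
  leaves a single binomial coefficient.\<close>

lemma K_even:
  assumes "m \<ge> 2"
  shows "K (2 * m) = 2 ^ (2 * m - 2) / real ((2 * m - 2) choose m)"
proof -
  obtain k where m: "m = k + 2"
    using assms by (metis add.commute le_Suc_ex)
  have "real ((2 * m - 2) choose m) = fact (2 * k + 2) / (fact (k + 2) * fact k)"
    unfolding m by (subst binomial_fact) (auto simp: algebra_simps)
  moreover have "fact (m - 1) = real (k + 1) * fact k" "fact m = (fact (k + 2) :: real)"
    "fact (2 * m - 2) = (fact (2 * k + 2) :: real)" "real (2 * m - 2) = 2 * real (k + 1)"
    "2 ^ (2 * m - 1) = (2 :: real) * 2 ^ (2 * m - 2)"
    "m \<le> 2 * m - 2"
    by (simp_all add: m)
  ultimately show ?thesis
    unfolding K_def by (simp del: fact_Suc of_nat_Suc of_nat_add add: divide_simps mult_ac)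
qed

lemma K_pos:
  assumes "d \<ge> 3"
  shows "K d > 0"
proof (cases "odd d")
  case True
  then show ?thesis
    by (auto elim!: oddE simp: K_odd[simplified])
next
  case False
  then obtain m where "d = 2 * m"
    by (auto elim!: evenE)
  then show ?thesis
    using assms K_even[of m] by simp
qed

text \<open>This identity is what makes the mechanism unbiased in every coordinate at once. It is
  immediate from the pivotal counts except for \<open>j = 1\<close> and even \<open>d\<close>, where
  the rescaling has to match the ratio of \<open>(2 * m) choose m\<close> to
  \<open>(2 * m - 2) choose m\<close>.\<close>

lemma card_pivotal:
  assumes "d \<ge> 3" "j \<in> {1..d}"
  shows "rescale_factor d j * real (card (pivotal d j)) * K d = 2 ^ (d - 1)"
proof (cases "odd d")
  case True
  then obtain m where d: "d = 2 * m + 1"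
    by (auto elim!: oddE)
  have "card (pivotal d j) = (2 * m) choose m"
    using card_pivotal_odd[of j m] assms unfolding d by blast
  then show ?thesis
    unfolding d K_odd rescale_factor_def by simp
next
  case False
  then obtain m where d: "d = 2 * m"
    by (auto elim!: evenE)
  then have m: "m \<ge> 2"
    using assms by simp
  then obtain k where k: "m = k + 2"
    by (metis add.commute le_Suc_ex)
  have pow: "2 ^ (d - 1) = (2 :: real) * 2 ^ (2 * m - 2)"
    by (simp add: d k)
  have pos: "real ((2 * m - 2) choose m) > 0"
    using m by simp
  show ?thesis
  proof (cases "j = 1")
    case False
    then have "card (pivotal d j) = 2 * ((2 * m - 2) choose m)"
      using card_pivotal_even[of m j] assms m unfolding d by auto
    then show ?thesis
      using pos False unfolding pow by (simp add: rescale_factor_def K_even[OF m] d)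
  next
    case True
    \<comment> \<open>Naming the factorials keeps the simplifier from unfolding them: both binomials
      become rational functions of \<open>k\<close> times powers of \<open>F\<close> and
      \<open>g\<close>, and the identity between them is purely algebraic.\<close>
    define F g :: real where "F = fact (2 * k + 2)" and "g = fact k"
    have "real ((2 * m - 2) choose m) = fact (2 * k + 2) / (fact (k + 2) * fact k)"
      unfolding k by (subst binomial_fact) (auto simp: algebra_simps)
    also have "fact (k + 2) = real (k + 2) * real (k + 1) * fact k"
      by (simp add: numeral_eq_Suc)
    finally have 1: "real ((2 * m - 2) choose m) = F / (real (k + 2) * real (k + 1) * g * g)"
      by (simp only: F_def g_def)
    have "2 * m = 2 * k + 4" "2 * k + 4 - (k + 2) = k + 2"
      by (simp_all add: k)
    then have "real ((2 * m) choose m) = fact (2 * k + 4) / (fact (k + 2) * fact (k + 2))"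
      using binomial_fact[of "k + 2" "2 * k + 4"] by (simp only: k) simp
    also have "fact (2 * k + 4) = real (2 * k + 4) * real (2 * k + 3) * fact (2 * k + 2)"
      by (simp add: numeral_eq_Suc)
    also have "fact (k + 2) = real (k + 2) * real (k + 1) * fact k"
      by (simp add: numeral_eq_Suc)
    finally have 2: "real ((2 * m) choose m) = real (2 * k + 4) * real (2 * k + 3) * F /
        (real (k + 2) * real (k + 1) * g * (real (k + 2) * real (k + 1) * g))"
      by (simp only: F_def g_def)
    have "F \<noteq> 0" "g \<noteq> 0"
      by (simp_all add: F_def g_def)
    then have "real ((2 * m) choose m) * (2 * real k + 2) = 4 * (2 * real k + 3) * real ((2 * m - 2) choose m)"
      unfolding 1 2 by (simp add: divide_simps) (simp add: algebra_simps)
    then have *: "(real d - 2) / (2 * (real d - 1)) * real ((2 * m) choose m) = 2 * real ((2 * m - 2) choose m)"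
      by (simp add: d k field_simps)
    have "card (pivotal d j) = (2 * m) choose m"
      using card_pivotal_even_1[of m] m True unfolding d by simp
    then have "rescale_factor d j * real (card (pivotal d j)) = 2 * real ((2 * m - 2) choose m)"
      using * True d by (simp add: rescale_factor_def)
    then show ?thesis
      unfolding pow using pos by (simp add: K_even[OF m] d)
  qed
qed

section \<open>Unbiasedness and boundedness of the mechanism\<close>

text \<open>A vector \<open>z\<close> is encoded by the set \<open>A\<close> of coordinates where it
  agrees with \<open>b * x\<close>. Then the inner product is \<open>b * (2 * card A - d)\<close>,
  so its sign tells which side has the majority, and the tie rule on \<open>z 1\<close> becomes
  \<open>1 \<in> A\<close>.\<close>

lemma agree_set_bij:
  assumes "b > 0" "x \<in> {1..d} \<rightarrow> {-1, 1}" "d \<ge> 1"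
  shows "bij_betw (\<lambda>A. \<lambda>j\<in>{1..d}. if j \<in> A then b * x j else - (b * x j)) (majority d) (agree_set b d x)"
    (is "bij_betw ?f _ _")
proof -
  have x: "x j = 1 \<or> x j = - 1" if "j \<in> {1..d}" for j
    using assms that by (auto simp: Pi_iff)
  have inner: "inner_vec d z x = b * (2 * real (card {j \<in> {1..d}. z j = b * x j}) - real d)"
    if z: "z \<in> {1..d} \<rightarrow>\<^sub>E {- b, b}" for z
  proof -
    let ?A = "{j \<in> {1..d}. z j = b * x j}"
    have "z j * x j = b * (2 * of_bool (z j = b * x j) - 1)" if "j \<in> {1..d}" for j
      using x[OF that] PiE_mem[OF z that] \<open>b > 0\<close> by auto
    then have "inner_vec d z x = (\<Sum>j=1..d. b * (2 * of_bool (z j = b * x j) - 1))"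
      unfolding inner_vec_def by (intro sum.cong) auto
    also have "\<dots> = b * (2 * (\<Sum>j=1..d. of_bool (z j = b * x j)) - real d)"
      by (simp add: sum_subtractf flip: sum_distrib_left)
    also have "(\<Sum>j=1..d. of_bool (z j = b * x j)) = real (card ?A)"
      by (simp add: of_bool_def sum.If_cases Int_def)
    finally show ?thesis .
  qed
  have agree: "z \<in> agree_set b d x \<longleftrightarrow> {j \<in> {1..d}. z j = b * x j} \<in> majority d"
    if z: "z \<in> {1..d} \<rightarrow>\<^sub>E {- b, b}" for z
    using z assms(1,3) unfolding agree_set_def majority_def mem_Collect_eq inner[OF z]
    by (auto simp: zero_less_mult_iff)
  have sub: "A \<subseteq> {1..d}" if "A \<in> majority d" for A
    using that by (simp add: majority_def)
  have f: "?f A \<in> {1..d} \<rightarrow>\<^sub>E {- b, b}" for A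
  proof -
    have "(if j \<in> A then b * x j else - (b * x j)) \<in> {- b, b}" if "j \<in> {1..d}" for j
      using x[OF that] by auto
    then show ?thesis
      by (intro restrict_PiE_iff[THEN iffD2] ballI)
  qed
  have f_set: "{j \<in> {1..d}. ?f A j = b * x j} = A" if "A \<in> majority d" for A
  proof -
    have "?f A j = b * x j \<longleftrightarrow> j \<in> A" if "j \<in> {1..d}" for j
      using x[OF that] that \<open>b > 0\<close> by auto
    then show ?thesis
      using sub[OF that] by blast
  qed
  show ?thesis
  proof (rule bij_betw_byWitness[where f' = "\<lambda>z. {j \<in> {1..d}. z j = b * x j}"])
    show "\<forall>A\<in>majority d. {j \<in> {1..d}. ?f A j = b * x j} = A"
      using f_set by blast
    show "?f ` majority d \<subseteq> agree_set b d x"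
      using agree[OF f] f_set by auto
    show "(\<lambda>z. {j \<in> {1..d}. z j = b * x j}) ` agree_set b d x \<subseteq> majority d"
      using agree unfolding agree_set_def by blast
    show "\<forall>z\<in>agree_set b d x. ?f {j \<in> {1..d}. z j = b * x j} = z"
    proof (intro ballI ext)
      fix z j assume "z \<in> agree_set b d x"
      then have z: "z \<in> {1..d} \<rightarrow>\<^sub>E {- b, b}"
        by (simp add: agree_set_def)
      show "?f {j \<in> {1..d}. z j = b * x j} j = z j"
        using PiE_mem[OF z, of j] PiE_arb[OF z, of j] x[of j] by auto
    qed
  qed
qed

lemma disagree_set_eq: "disagree_set b d x = agree_set b d (\<lambda>j. - x j)"
  by (simp add: disagree_set_def agree_set_def inner_vec_def sum_negf)

text \<open>Everything is transported along the encoding by majorities. There the coordinate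
  \<open>j\<close> of \<open>z\<close> is \<open>b * x j\<close> times the sign of the vote of
  \<open>j\<close>, so the sum reduces to the signed count over majorities.\<close>

lemma agree_set_stats:
  assumes "b > 0" "x \<in> {1..d} \<rightarrow> {-1, 1}" "d \<ge> 1"
  shows finite_agree_set: "finite (agree_set b d x)"
    and agree_set_nonempty: "agree_set b d x \<noteq> {}"
    and card_agree_set: "card (agree_set b d x) = 2 ^ (d - 1)"
    and sum_agree_set: "j \<in> {1..d} \<Longrightarrow>
      (\<Sum>z\<in>agree_set b d x. z j) = b * x j * real (card (pivotal d j))"
proof -
  note bij = agree_set_bij[OF assms]
  show fin: "finite (agree_set b d x)"
    using bij_betw_finite[OF bij] finite_majority by simp
  show card: "card (agree_set b d x) = 2 ^ (d - 1)"
    using bij_betw_same_card[OF bij] card_majority[OF assms(3)] by simp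
  then show "agree_set b d x \<noteq> {}"
    by auto
  assume j: "j \<in> {1..d}"
  have "(\<Sum>z\<in>agree_set b d x. z j) = (\<Sum>A\<in>majority d. if j \<in> A then b * x j else - (b * x j))"
    using sum.reindex_bij_betw[OF bij, of "\<lambda>z. z j"] j by simp
  also have "\<dots> = b * x j * (\<Sum>A\<in>majority d. if j \<in> A then 1 else - 1)"
    unfolding sum_distrib_left by (intro sum.cong) auto
  finally show "(\<Sum>z\<in>agree_set b d x. z j) = b * x j * real (card (pivotal d j))"
    using sum_signs_majority[OF j] by simp
qed

lemma B_pos:
  assumes "\<alpha> > 0" "d \<ge> 3"
  shows "B \<alpha> d > 0"
  unfolding B_def using assms K_pos[of d]
  by (intro mult_pos_pos divide_pos_pos add_pos_pos) simp_all

text \<open>Two attenuations occur: the Bernoulli draw contributes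
  \<open>2 * ?q - 1 = (exp \<alpha> - 1) / (exp \<alpha> + 1)\<close>, and the uniform draw
  contributes \<open>1 / K d\<close> after rescaling. The amplitude \<open>B \<alpha> d\<close> is
  the product of the inverses of both.\<close>

lemma
  assumes "\<alpha> > 0" "d \<ge> 3" "x \<in> {1..d} \<rightarrow> {-1, 1}" "j \<in> {1..d}"
  shows expectation_privatize: "measure_pmf.expectation (privatize \<alpha> d x) (\<lambda>z. z j) = x j"
    and privatize_bounded: "\<And>z. z \<in> set_pmf (privatize \<alpha> d x) \<Longrightarrow> \<bar>z j\<bar> \<le> B \<alpha> d"
proof -
  define b where "b = B \<alpha> d"
  let ?q = "exp \<alpha> / (exp \<alpha> + 1)" and ?w = "rescale_factor d j" and ?P = "real (card (pivotal d j))"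
  let ?S = "\<lambda>y. if y then agree_set b d x else disagree_set b d x"
  have b: "b > 0"
    using B_pos assms by (simp add: b_def)
  have pos: "exp \<alpha> + 1 > 0"
    by (simp add: add_pos_pos)
  have q: "0 \<le> ?q" "?q \<le> 1"
    by (auto simp: field_simps add_pos_pos)
  have nx: "(\<lambda>j. - x j) \<in> {1..d} \<rightarrow> {-1, 1}"
    using assms by (auto simp: Pi_iff)
  have alg: "u * t - (1 - u) * t = (2 * u - 1) * t" for u t :: real
    by (simp add: algebra_simps)
  have d: "d \<ge> 1"
    using assms by simp
  have S: "finite (?S y)" "?S y \<noteq> {}" for y
    using finite_agree_set[OF b assms(3) d] agree_set_nonempty[OF b assms(3) d]
      finite_agree_set[OF b nx d] agree_set_nonempty[OF b nx d] by (auto simp: disagree_set_eq)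
  have E: "measure_pmf.expectation (map_pmf (rescale d) (pmf_of_set (?S y))) (\<lambda>z. z j)
      = (if y then 1 else - 1) * (?w * (b * x j * ?P) / 2 ^ (d - 1))" for y
    unfolding integral_map_pmf integral_pmf_of_set[OF S(2,1)] rescale_eq sum_distrib_left[symmetric]
    using sum_agree_set[OF b assms(3) d assms(4)] sum_agree_set[OF b nx d assms(4)]
      card_agree_set[OF b assms(3) d] card_agree_set[OF b nx d]
    by (auto simp: disagree_set_eq)
  \<comment> \<open>Expanding the fraction by \<open>K d\<close> brings in the product evaluated by
    \<open>card_pivotal\<close>.\<close>
  have "?w * (b * x j * ?P) / 2 ^ (d - 1) = b * x j * (?w * ?P * K d) / (K d * 2 ^ (d - 1))"
    using K_pos[of d] assms by simp
  also have "\<dots> = b * x j / K d"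
    unfolding card_pivotal[OF assms(2,4)] by simp
  finally have simp: "?w * (b * x j * ?P) / 2 ^ (d - 1) = b * x j / K d" .
  have "measure_pmf.expectation (privatize \<alpha> d x) (\<lambda>z. z j)
      = (\<Sum>y\<in>UNIV. pmf (bernoulli_pmf ?q) y *\<^sub>R
          measure_pmf.expectation (map_pmf (rescale d) (pmf_of_set (?S y))) (\<lambda>z. z j))"
    unfolding privatize_def b_def[symmetric] using S
    by (intro pmf_expectation_bind) simp_all
  also have "\<dots> = ?q * (b * x j / K d) - (1 - ?q) * (b * x j / K d)"
    unfolding E simp using q by (simp add: UNIV_bool)
  also have "\<dots> = (2 * ?q - 1) * (b * x j / K d)"
    by (rule alg)
  also have "2 * ?q - 1 = (exp \<alpha> - 1) / (exp \<alpha> + 1)"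
    using pos by (simp add: divide_simps)
  also have "\<dots> * (b * x j / K d) = x j"
  proof -
    have "exp \<alpha> - 1 \<noteq> 0" "K d \<noteq> 0"
      using assms(1) K_pos[OF assms(2)] by simp_all
    then show ?thesis
      using pos by (simp add: b_def B_def)
  qed
  finally show "measure_pmf.expectation (privatize \<alpha> d x) (\<lambda>z. z j) = x j" .
  fix z assume "z \<in> set_pmf (privatize \<alpha> d x)"
  then obtain y u where u: "u \<in> ?S y" "z = rescale d u"
    unfolding privatize_def b_def[symmetric] using S by auto
  then have "u \<in> {1..d} \<rightarrow>\<^sub>E {- b, b}"
    by (auto simp: agree_set_def disagree_set_def split: if_splits)
  then have "u j \<in> {- b, b}"
    using assms(4) by (rule PiE_mem)
  then have "\<bar>u j\<bar> = b"
    using b by auto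
  moreover have "\<bar>z j\<bar> = ?w * \<bar>u j\<bar>"
    using rescale_factor_bounds(1)[OF assms(2), of j] unfolding u(2) rescale_eq by (simp only: abs_mult abs_of_nonneg)
  ultimately show "\<bar>z j\<bar> \<le> B \<alpha> d"
    using rescale_factor_bounds[OF assms(2), of j] b unfolding b_def[symmetric]
    by (simp only: mult_left_le_one_le less_imp_le)
qed

section \<open>Noise density and the expected sign of an observation\<close>

text \<open>An even convex function is nondecreasing in the absolute value, since \<open>x\<close>
  lies between \<open>- y\<close> and \<open>y\<close>, where the function takes the same value.
  Measurability comes from continuity of a finite convex function.\<close>

lemma symmetric_strongly_log_concaveD:
  assumes "symmetric_strongly_log_concave c p"
  shows strongly_log_concave_pos: "p x > 0"
    and strongly_log_concave_even: "p (- x) = p x"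
    and strongly_log_concave_antimono: "\<bar>x\<bar> \<le> \<bar>y\<bar> \<Longrightarrow> p y \<le> p x"
    and strongly_log_concave_measurable: "p \<in> borel_measurable borel"
proof -
  obtain \<phi> where \<phi>: "convex_on UNIV \<phi>" "\<And>x. \<phi> (- x) = \<phi> x"
    and p: "\<And>x. p x = exp (- \<phi> x) * exp (- c * x\<^sup>2 / 2)" and c: "c > 0"
    using assms unfolding symmetric_strongly_log_concave_def by blast
  show "p x > 0" "p (- x) = p x"
    by (simp_all add: p \<phi>)
  show "p y \<le> p x" if xy: "\<bar>x\<bar> \<le> \<bar>y\<bar>"
  proof -
    have "\<phi> x \<le> \<phi> y"
    proof (cases "y = 0")
      case False
      \<comment> \<open>The weight that solves \<open>x = (1 - u) * (- y) + u * y\<close>.\<close>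
      define u where "u = (1 + x / y) / 2"
      have "\<bar>x / y\<bar> \<le> 1"
        using xy False by (simp add: abs_divide)
      then have u: "0 \<le> u" "u \<le> 1"
        unfolding u_def abs_le_iff by simp_all
      have "x = (1 - u) *\<^sub>R (- y) + u *\<^sub>R y"
        using False by (simp add: u_def field_simps)
      then have "\<phi> x \<le> (1 - u) * \<phi> (- y) + u * \<phi> y"
        using convex_onD[OF \<phi>(1) u, of "- y" y] by simp
      then show ?thesis
        by (simp add: \<phi>(2) algebra_simps)
    qed (use xy in simp)
    moreover have "c * x\<^sup>2 \<le> c * y\<^sup>2"
      using c xy by (simp add: abs_le_square_iff)
    ultimately show ?thesis
      unfolding p by (intro mult_mono) simp_all
  qed
  have "continuous_on UNIV \<phi>"
    using convex_on_continuous[OF open_UNIV \<phi>(1)] .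
  then have [measurable]: "\<phi> \<in> borel_measurable borel"
    by (rule borel_measurable_continuous_onI)
  show "p \<in> borel_measurable borel"
    unfolding p[abs_def] by measurable
qed

lemma sets_noise_law [simp, measurable_cong]: "sets (noise_law p) = sets borel"
  and space_noise_law [simp]: "space (noise_law p) = UNIV"
  by (simp_all add: noise_law_def)

lemma measurable_sgn1 [measurable]: "sgn1 \<in> borel_measurable borel"
  unfolding sgn1_def[abs_def] by measurable

text \<open>Symmetrising \<open>\<xi>\<close> against \<open>-\<xi>\<close> cancels the sign outside the interval \<open>\<bar>\<sigma> \<xi>\<bar> \<le> t\<close>.\<close>

lemma expectation_sgn1:
  assumes p: "symmetric_strongly_log_concave c p" and N: "prob_space (noise_law p)"
    and "\<sigma> > 0" "t \<ge> 0"
  shows "(\<integral>u. sgn1 (t + \<sigma> * u) \<partial>noise_law p) = measure (noise_law p) {- (t / \<sigma>)..t / \<sigma>}"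
proof -
  interpret prob_space "noise_law p" by (rule N)
  note [measurable] = strongly_log_concave_measurable[OF p]
  have pos: "0 \<le> p u" for u
    using strongly_log_concave_pos[OF p, of u] by simp
  let ?f = "\<lambda>r u. sgn1 (t + r * u)"
  have int: "integrable (noise_law p) (?f r)" for r
    by (rule integrable_const_bound[where B = 1]) (auto simp: sgn1_def)
  have dens: "(\<integral>u. f u \<partial>noise_law p) = (\<integral>u. p u * f u \<partial>lborel)"
    if "f \<in> borel_measurable borel" for f :: "real \<Rightarrow> real"
    unfolding noise_law_def using that pos by (subst integral_density) auto
  have "(\<integral>u. ?f \<sigma> u \<partial>noise_law p) = (\<integral>u. p u * ?f \<sigma> u \<partial>lborel)"
    by (rule dens) measurable
  \<comment> \<open>The reflection of \<open>u\<close> preserves Lebesgue measure and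
    \<open>p\<close>, and turns \<sigma> into its negative.\<close>
  also have "\<dots> = (\<integral>u. p u * ?f (- \<sigma>) u \<partial>lborel)"
    by (subst lborel_integral_real_affine[where t = 0 and c = "-1"])
      (simp_all add: strongly_log_concave_even[OF p])
  also have "\<dots> = (\<integral>u. ?f (- \<sigma>) u \<partial>noise_law p)"
    by (rule dens[symmetric]) measurable
  finally have "2 * (\<integral>u. ?f \<sigma> u \<partial>noise_law p)
      = (\<integral>u. ?f \<sigma> u \<partial>noise_law p) + (\<integral>u. ?f (- \<sigma>) u \<partial>noise_law p)"
    by simp
  also have "\<dots> = (\<integral>u. ?f \<sigma> u + ?f (- \<sigma>) u \<partial>noise_law p)"
    by (rule Bochner_Integration.integral_add[OF int int, symmetric])
  also have "\<dots> = (\<integral>u. 2 * indicator {- (t / \<sigma>)..t / \<sigma>} u \<partial>noise_law p)"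
  proof (rule Bochner_Integration.integral_cong[OF refl])
    fix u
    have "- (t / \<sigma>) \<le> u \<longleftrightarrow> - t \<le> \<sigma> * u" "u \<le> t / \<sigma> \<longleftrightarrow> \<sigma> * u \<le> t"
      using assms(3) by (simp_all add: field_simps)
    then have "- (t / \<sigma>) \<le> u \<longleftrightarrow> 0 \<le> t + \<sigma> * u" "u \<le> t / \<sigma> \<longleftrightarrow> 0 \<le> t + (- \<sigma>) * u"
      by linarith+
    \<comment> \<open>Since \<open>t \<ge> 0\<close>, the two signs are never both
      \<open>-1\<close>: they are both \<open>1\<close> inside the interval and opposite
      outside.\<close>
    moreover have "0 \<le> t + \<sigma> * u \<or> 0 \<le> t + (- \<sigma>) * u"
      using assms(4) by linarith
    ultimately show "?f \<sigma> u + ?f (- \<sigma>) u = 2 * indicator {- (t / \<sigma>)..t / \<sigma>} u"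
      by (auto simp: sgn1_def indicator_def)
  qed
  finally show ?thesis
    by simp
qed

text \<open>For \<open>t = 0\<close> the interval shrinks to a point, which is null for a law with a
  density; the convention for the sign at \<open>0\<close> therefore causes no bias.\<close>

lemma expectation_sgn1_zero:
  assumes p: "symmetric_strongly_log_concave c p" and N: "prob_space (noise_law p)" and "\<sigma> > 0"
  shows "(\<integral>u. sgn1 (\<sigma> * u) \<partial>noise_law p) = 0"
proof -
  note [measurable] = strongly_log_concave_measurable[OF p]
  have "AE u in lborel. u \<noteq> (0::real)"
    by (rule AE_lborel_singleton)
  then have "emeasure (noise_law p) {0} = 0"
    unfolding noise_law_def
    by (subst emeasure_density) (auto intro!: nn_integral_0_iff_AE[THEN iffD2] elim!: eventually_mono)
  then show ?thesis
    using expectation_sgn1[OF p N \<open>\<sigma> > 0\<close>, of 0] by (simp add: measure_def)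
qed

text \<open>The interval of radius \<open>a / \<sigma> \<le> 2\<close> lies where the density is at
  least \<open>p 2\<close>, and its length supplies the factor \<open>2\<close>. That factor leaves
  a gap of at least \<open>p 2 * a / \<sigma>\<close> between the mean and the selection
  threshold.\<close>

lemma expectation_sgn1_ge:
  assumes p: "symmetric_strongly_log_concave c p" and N: "prob_space (noise_law p)"
    and "\<sigma> > 0" "0 < a" "a \<le> 2 * \<sigma>" "a \<le> t"
  shows "2 * (p 2 * a / \<sigma>) \<le> (\<integral>u. sgn1 (t + \<sigma> * u) \<partial>noise_law p)"
proof -
  interpret prob_space "noise_law p" by (rule N)
  note [measurable] = strongly_log_concave_measurable[OF p]
  define r where "r = a / \<sigma>"
  have r: "0 < r" "r \<le> 2" "r \<le> t / \<sigma>"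
    using assms by (simp_all add: r_def field_simps)
  have p2: "p 2 > 0"
    by (rule strongly_log_concave_pos[OF p])
  have "ennreal (p 2 * (2 * r)) = (\<integral>\<^sup>+u. ennreal (p 2) * indicator {- r..r} u \<partial>lborel)"
    using r p2 by (subst nn_integral_cmult) (auto simp: ennreal_mult)
  also have "\<dots> \<le> (\<integral>\<^sup>+u. ennreal (p u) * indicator {- r..r} u \<partial>lborel)"
    using r by (intro nn_integral_mono)
      (auto simp: indicator_def intro!: ennreal_leI strongly_log_concave_antimono[OF p])
  also have "\<dots> = emeasure (noise_law p) {- r..r}"
    unfolding noise_law_def by (subst emeasure_density) auto
  also have "\<dots> = ennreal (prob {- r..r})"
    by (rule emeasure_eq_measure)
  finally have "p 2 * (2 * r) \<le> prob {- r..r}"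
    by (simp add: measure_nonneg)
  also have "\<dots> \<le> prob {- (t / \<sigma>)..t / \<sigma>}"
    using r by (intro finite_measure_mono) auto
  also have "\<dots> = (\<integral>u. sgn1 (t + \<sigma> * u) \<partial>noise_law p)"
    using expectation_sgn1[OF p N \<open>\<sigma> > 0\<close>, of t] assms by simp
  finally show ?thesis
    by (simp add: r_def mult_ac)
qed

section \<open>Concentration of an empirical mean under a product measure\<close>

text \<open>The coordinate projections of a power of \<open>N\<close> are independent with law
  \<open>N\<close>, so Hoeffding's inequality for i.i.d. bounded variables applies to
  \<open>f\<close> composed with them.\<close>

lemma Hoeffding_PiM:
  fixes f :: "'a \<Rightarrow> real" and n :: nat
  defines "M \<equiv> \<lambda>N. \<Pi>\<^sub>M i\<in>{1..n}. N"
  assumes N: "prob_space N" and f [measurable]: "f \<in> borel_measurable N"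
    and bound: "AE z in N. \<bar>f z\<bar> \<le> b" and "b > 0" "n \<ge> 1" "\<epsilon> \<ge> 0"
  shows "measure (M N) {Z \<in> space (M N). 1 / real n * (\<Sum>i=1..n. f (Z i)) \<ge> (\<integral>z. f z \<partial>N) + \<epsilon>}
           \<le> exp (- (real n * \<epsilon>\<^sup>2 / (2 * b\<^sup>2)))" (is ?ge)
    and "measure (M N) {Z \<in> space (M N). 1 / real n * (\<Sum>i=1..n. f (Z i)) \<le> (\<integral>z. f z \<partial>N) - \<epsilon>}
           \<le> exp (- (real n * \<epsilon>\<^sup>2 / (2 * b\<^sup>2)))" (is ?le)
proof -
  interpret N: prob_space N by (rule N)
  interpret M: prob_space "M N"
    unfolding M_def by (intro prob_space_PiM N)
  have comp: "(\<lambda>Z. Z i) \<in> M N \<rightarrow>\<^sub>M N" if "i \<in> {1..n}" for i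
    unfolding M_def using that by measurable
  have distr: "distr (M N) N (\<lambda>Z. Z i) = N" if "i \<in> {1..n}" for i
    unfolding M_def using that by (intro distr_PiM_component N)
  have fcomp: "(\<lambda>Z. f (Z i)) \<in> borel_measurable (M N)" if "i \<in> {1..n}" for i
    using measurable_compose[OF comp[OF that] f] .
  have distr_f: "distr (M N) borel (\<lambda>Z. f (Z i)) = distr N borel f" if "i \<in> {1..n}" for i
    using distr_distr[OF f comp[OF that]] distr[OF that] by (simp add: comp_def)
  \<comment> \<open>Independence is obtained from the criterion that the joint law be the product of
    the marginals; here the joint law of the projections is the product measure itself.\<close>
  have "distr (M N) (\<Pi>\<^sub>M i\<in>{1..n}. N) (\<lambda>Z. \<lambda>i\<in>{1..n}. Z i) = distr (M N) (M N) (\<lambda>Z. Z)"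
    by (intro distr_cong) (auto simp: M_def space_PiM)
  also have "\<dots> = (\<Pi>\<^sub>M i\<in>{1..n}. distr (M N) N (\<lambda>Z. Z i))"
    unfolding distr_id by (subst M_def) (intro PiM_cong refl distr[symmetric])
  finally have "M.indep_vars (\<lambda>_. N) (\<lambda>i Z. Z i) {1..n}"
    using \<open>n \<ge> 1\<close> by (subst M.indep_vars_iff_distr_eq_PiM') (auto intro: comp)
  then have indep: "M.indep_vars (\<lambda>_. borel) (\<lambda>i Z. f (Z i)) {1..n}"
    by (rule M.indep_vars_compose2) auto
  have one: "1 \<in> {1..n}"
    using \<open>n \<ge> 1\<close> by simp
  have expect: "M.expectation (\<lambda>Z. f (Z 1)) = (\<integral>z. f z \<partial>N)"
    using integral_distr[OF comp[OF one] f] distr[OF one] by simp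
  interpret H: Hoeffding_ineq_iid "M N" "{1..n}" "\<lambda>i Z. f (Z i)" "\<lambda>Z. f (Z 1)" "- b" b "\<integral>z. f z \<partial>N"
  proof (unfold_locales)
    have "AE Z in M N. \<bar>f (Z 1)\<bar> \<le> b"
      unfolding M_def using bound one by (intro AE_PiM_component N) auto
    then show "AE Z in M N. f (Z 1) \<in> {- b..b}"
      by (rule eventually_mono) auto
    show "(\<integral>z. f z \<partial>N) \<equiv> M.expectation (\<lambda>Z. f (Z 1))"
      using expect by simp
    show "distr (M N) borel (\<lambda>Z. f (Z i)) = distr (M N) borel (\<lambda>Z. f (Z 1))" if "i \<in> {1..n}" for i
      using distr_f[OF that] distr_f[OF one] by simp
  qed (use indep fcomp one in simp_all)
  \<comment> \<open>The range has length \<open>2 * b\<close>, which turns the general exponent into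
    the stated one.\<close>
  have e: "- 2 * real (card {1..n}) * \<epsilon>\<^sup>2 / (b - - b)\<^sup>2 = - (real n * \<epsilon>\<^sup>2 / (2 * b\<^sup>2))"
    using \<open>b > 0\<close> by (simp add: power2_eq_square field_simps)
  have "- b < b" "{1..n} \<noteq> {}"
    using \<open>b > 0\<close> \<open>n \<ge> 1\<close> by simp_all
  then show ?ge ?le
    using H.Hoeffding_ineq_ge'[OF \<open>\<epsilon> \<ge> 0\<close>] H.Hoeffding_ineq_le'[OF \<open>\<epsilon> \<ge> 0\<close>]
    unfolding e by simp_all
qed

section \<open>Law of one privatized observation\<close>

lemma sgn1_vector_in: "(\<lambda>j\<in>{1..d}. sgn1 (x j)) \<in> {1..d} \<rightarrow>\<^sub>E {-1, 1}"
  by (auto simp: sgn1_def)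

text \<open>The kernel factors through the sign vector, which takes finitely many values. Only
  measurability into that finite discrete space needs work, because out of it every family of
  probability laws is measurable.\<close>

lemma measurable_privatize:
  "(\<lambda>x. measure_pmf (privatize \<alpha> d (\<lambda>j\<in>{1..d}. sgn1 (x j))))
     \<in> (\<Pi>\<^sub>M j\<in>{1..d}. borel) \<rightarrow>\<^sub>M prob_algebra (count_space UNIV)"
proof -
  let ?V = "{1..d} \<rightarrow>\<^sub>E {-1, 1::real}"
  let ?g = "\<lambda>x. \<lambda>j\<in>{1..d}. sgn1 (x j)"
  have "finite ?V"
    by (intro finite_PiE) auto
  moreover have "?g -` {v} \<inter> space (\<Pi>\<^sub>M j\<in>{1..d}. borel) \<in> sets (\<Pi>\<^sub>M j\<in>{1..d}. borel)" if "v \<in> ?V" for v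
  proof -
    have "?g -` {v} \<inter> space (\<Pi>\<^sub>M j\<in>{1..d}. borel)
        = {x \<in> space (\<Pi>\<^sub>M j\<in>{1..d}. borel). \<forall>j\<in>{1..d}. sgn1 (x j) = v j}"
      using that by (auto simp: restrict_def fun_eq_iff PiE_iff extensional_def)
    also have "\<dots> \<in> sets (\<Pi>\<^sub>M j\<in>{1..d}. borel)"
      by measurable
    finally show ?thesis .
  qed
  ultimately have "?g \<in> (\<Pi>\<^sub>M j\<in>{1..d}. borel) \<rightarrow>\<^sub>M count_space ?V"
    by (subst measurable_count_space_eq2) (use sgn1_vector_in in blast)+
  moreover have "(\<lambda>v. measure_pmf (privatize \<alpha> d v)) \<in> count_space ?V \<rightarrow>\<^sub>M prob_algebra (count_space UNIV)"
    by (simp add: space_prob_algebra measure_pmf.prob_space_axioms)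
  ultimately show ?thesis
    by (rule measurable_compose)
qed

lemma observation_law_in_prob_algebra:
  assumes "prob_space (noise_law p)"
  shows "observation_law p \<sigma> d \<theta> \<in> space (prob_algebra (\<Pi>\<^sub>M j\<in>{1..d}. borel))"
  unfolding observation_law_def space_prob_algebra
  using assms by (auto intro!: prob_space.prob_space_distr prob_space_PiM)

lemma private_law_in_prob_algebra:
  assumes "prob_space (noise_law p)"
  shows "private_law p \<sigma> \<alpha> d \<theta> \<in> space (prob_algebra (count_space UNIV))"
  using prob_space_bind'[OF observation_law_in_prob_algebra[OF assms] measurable_privatize]
    sets_bind'[OF observation_law_in_prob_algebra[OF assms] measurable_privatize]
  by (simp add: space_prob_algebra private_law_def)

text \<open>Conditioning on the observation, the mechanism is unbiased for the sign, so the mean is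
  the expected sign of coordinate \<open>j\<close>. This depends on the noise vector through its
  \<open>j\<close>-th component only, whose law is \<open>noise_law p\<close>.\<close>

lemma
  assumes N: "prob_space (noise_law p)" and "\<alpha> > 0" "d \<ge> 3" "j \<in> {1..d}"
  shows private_law_bounded: "AE z in private_law p \<sigma> \<alpha> d \<theta>. \<bar>z j\<bar> \<le> B \<alpha> d"
    and expectation_private_law:
      "(\<integral>z. z j \<partial>private_law p \<sigma> \<alpha> d \<theta>) = (\<integral>u. sgn1 (\<theta> j + \<sigma> * u) \<partial>noise_law p)"
proof -
  let ?O = "observation_law p \<sigma> d \<theta>" and ?S = "\<lambda>x. \<lambda>j\<in>{1..d}. sgn1 (x j)"
  let ?k = "\<lambda>x. measure_pmf (privatize \<alpha> d (?S x))" and ?b = "B \<alpha> d"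
  have setsO: "sets ?O = sets (\<Pi>\<^sub>M j\<in>{1..d}. borel)" and O: "prob_space ?O"
    using observation_law_in_prob_algebra[OF N, of \<sigma> d \<theta>] by (auto simp: space_prob_algebra)
  have k: "?k \<in> ?O \<rightarrow>\<^sub>M subprob_algebra (count_space UNIV)"
    using measurable_privatize[THEN measurable_prob_algebraD] measurable_cong_sets[OF setsO refl] by blast
  have S: "?S x \<in> {1..d} \<rightarrow> {-1, 1}" for x
    using sgn1_vector_in[of x d] by (auto simp: PiE_def)
  note bd = privatize_bounded[OF assms(2,3) S assms(4)]
  show AE: "AE z in private_law p \<sigma> \<alpha> d \<theta>. \<bar>z j\<bar> \<le> ?b"
    unfolding private_law_def by (subst AE_bind[OF k]) (auto simp: AE_measure_pmf_iff bd)
  have bpos: "?b > 0"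
    using B_pos assms by simp
  have setsP: "sets (private_law p \<sigma> \<alpha> d \<theta>) = UNIV"
    using private_law_in_prob_algebra[OF N, of \<sigma> \<alpha> d \<theta>] by (simp add: space_prob_algebra)
  \<comment> \<open>All sets of vectors are measurable for \<open>private_law\<close>, hence so are
    all functions.\<close>
  have meas: "f \<in> borel_measurable (private_law p \<sigma> \<alpha> d \<theta>)" for f :: "_ \<Rightarrow> real"
    using setsP by (subst measurable_cong_sets[of _ "count_space UNIV" borel borel]) simp_all
  txt \<open>The integral of a composed kernel is available for bounded functions only, hence the truncation.\<close>
  define g where "g z = max (- ?b) (min ?b (z j))" for z :: "nat \<Rightarrow> real"
  have g_eq: "g z = z j" if "\<bar>z j\<bar> \<le> ?b" for z
    using that by (auto simp: g_def)
  have "(\<integral>z. z j \<partial>private_law p \<sigma> \<alpha> d \<theta>) = (\<integral>z. g z \<partial>private_law p \<sigma> \<alpha> d \<theta>)"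
    using AE by (intro integral_cong_AE meas) (auto simp: g_eq elim!: eventually_mono)
  also have "\<dots> = (\<integral>x. (\<integral>z. g z \<partial>?k x) \<partial>?O)"
    unfolding private_law_def
  proof (rule integral_bind[OF _ _ k])
    show "\<bar>g z\<bar> \<le> ?b" for z
      using bpos by (auto simp: g_def)
    show "finite_measure ?O"
      using O prob_space.finite_measure by blast
    show "AE x in ?O. emeasure (?k x) (space (?k x)) \<le> ennreal 1"
      using measure_pmf.emeasure_space_1 by simp
  qed simp
  also have "\<dots> = (\<integral>x. sgn1 (x j) \<partial>?O)"
  proof (rule Bochner_Integration.integral_cong[OF refl])
    fix x
    have "(\<integral>z. g z \<partial>?k x) = (\<integral>z. z j \<partial>?k x)"
      by (intro integral_cong_AE) (auto simp: AE_measure_pmf_iff g_eq bd)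
    also have "\<dots> = sgn1 (x j)"
      using expectation_privatize[OF assms(2,3) S assms(4)] assms(4) by simp
    finally show "(\<integral>z. g z \<partial>?k x) = sgn1 (x j)" .
  qed
  also have "\<dots> = (\<integral>\<xi>. sgn1 (\<theta> j + \<sigma> * \<xi> j) \<partial>(\<Pi>\<^sub>M j\<in>{1..d}. noise_law p))"
    unfolding observation_law_def using assms(4) by (subst integral_distr) simp_all
  also have "\<dots> = (\<integral>u. sgn1 (\<theta> j + \<sigma> * u) \<partial>distr (\<Pi>\<^sub>M j\<in>{1..d}. noise_law p) (noise_law p) (\<lambda>\<xi>. \<xi> j))"
    using assms(4) by (subst integral_distr) simp_all
  also have "distr (\<Pi>\<^sub>M j\<in>{1..d}. noise_law p) (noise_law p) (\<lambda>\<xi>. \<xi> j) = noise_law p"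
    using assms(4) by (intro distr_PiM_component N)
  finally show "(\<integral>z. z j \<partial>private_law p \<sigma> \<alpha> d \<theta>) = (\<integral>u. sgn1 (\<theta> j + \<sigma> * u) \<partial>noise_law p)" .
qed

section \<open>Risk bound for fixed sample size and dimension\<close>

text \<open>The threshold is at distance at least \<tau> from either kind of mean, \<open>0\<close>
  off the support and at least \<open>2 * \<tau>\<close> on it. Both error types thus obey the same
  one-sided Hoeffding bound, and the expected loss is the sum of the error probabilities over the
  coordinates.\<close>

lemma expected_hamming_le:
  assumes p: "symmetric_strongly_log_concave c p" and N: "prob_space (noise_law p)"
    and \<sigma>: "\<sigma> > 0" and \<alpha>: "\<alpha> > 0" and d: "d \<ge> 3" and n: "n \<ge> 1" and a: "0 < a" "a \<le> 2 * \<sigma>"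
    and \<theta>: "\<theta> \<in> Theta_plus d s a"
  shows "expected_hamming p \<sigma> \<alpha> n d (p 2 * a / \<sigma>) \<theta>
    \<le> real d * exp (- (real n * (p 2 * a / \<sigma>)\<^sup>2 / (2 * (B \<alpha> d)\<^sup>2)))"
proof -
  define \<tau> where "\<tau> = p 2 * a / \<sigma>"
  let ?P = "private_law p \<sigma> \<alpha> d \<theta>" and ?M = "sample_law p \<sigma> \<alpha> n d \<theta>"
  let ?r = "exp (- (real n * \<tau>\<^sup>2 / (2 * (B \<alpha> d)\<^sup>2)))"
  let ?E = "\<lambda>j. {Z \<in> space ?M. selector \<tau> n Z j \<noteq> support_ind \<theta> j}"
  have P: "prob_space ?P" and setsP: "sets ?P = sets (count_space UNIV)"
    using private_law_in_prob_algebra[OF N, of \<sigma> \<alpha> d \<theta>] by (simp_all add: space_prob_algebra)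
  interpret M: prob_space ?M
    unfolding sample_law_def by (intro prob_space_PiM P)
  have \<tau>: "\<tau> \<ge> 0"
    using strongly_log_concave_pos[OF p, of 2] a \<sigma> by (simp add: \<tau>_def less_imp_le)
  have meas: "(\<lambda>z. z j) \<in> borel_measurable ?P" for j
    by (subst measurable_cong_sets[OF setsP refl]) simp
  have [measurable]: "(\<lambda>Z. Z i j) \<in> borel_measurable ?M" if "i \<in> {1..n}" for i j
    unfolding sample_law_def using measurable_compose[OF measurable_component_singleton[OF that] meas] .
  have E [measurable]: "?E j \<in> sets ?M" for j
    unfolding selector_def by measurable
  have prob_E: "M.prob (?E j) \<le> ?r" if j: "j \<in> {1..d}" for j
  proof -
    let ?\<mu> = "\<integral>z. z j \<partial>?P" and ?avg = "\<lambda>Z. 1 / real n * (\<Sum>i=1..n. Z i j)"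
    note H = Hoeffding_PiM[OF P meas private_law_bounded[OF N \<alpha> d j] B_pos[OF \<alpha> d] n \<tau>, folded sample_law_def]
    have E_eq: "?E j = {Z \<in> space ?M. (\<tau> \<le> ?avg Z) \<noteq> (\<theta> j \<noteq> 0)}"
      by (auto simp: selector_def support_ind_def)
    consider "\<theta> j = 0" | "a \<le> \<theta> j"
      using \<theta> j unfolding Theta_plus_def by blast
    then show ?thesis
    proof cases
      case 1
      then have "?\<mu> = 0"
        unfolding expectation_private_law[OF N \<alpha> d j] using expectation_sgn1_zero[OF p N \<sigma>] by simp
      then have "?E j \<subseteq> {Z \<in> space ?M. ?avg Z \<ge> ?\<mu> + \<tau>}"
        unfolding E_eq using 1 by auto
      then have "M.prob (?E j) \<le> M.prob {Z \<in> space ?M. ?avg Z \<ge> ?\<mu> + \<tau>}"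
        by (rule M.finite_measure_mono) measurable
      also note H(1)
      finally show ?thesis .
    next
      case 2
      then have "2 * \<tau> \<le> ?\<mu>"
        unfolding expectation_private_law[OF N \<alpha> d j] \<tau>_def using expectation_sgn1_ge[OF p N \<sigma> a] by simp
      \<comment> \<open>An error on the support means that the average stays below \<tau>, and
        \<tau> is at most \<open>?\<mu> - \<tau>\<close>.\<close>
      then have "?E j \<subseteq> {Z \<in> space ?M. ?avg Z \<le> ?\<mu> - \<tau>}"
        unfolding E_eq using 2 a by auto
      then have "M.prob (?E j) \<le> M.prob {Z \<in> space ?M. ?avg Z \<le> ?\<mu> - \<tau>}"
        by (rule M.finite_measure_mono) measurable
      also note H(2)
      finally show ?thesis .
    qed
  qed
  have "expected_hamming p \<sigma> \<alpha> n d \<tau> \<theta> = (\<integral>Z. (\<Sum>j=1..d. indicator (?E j) Z) \<partial>?M)"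
    unfolding expected_hamming_def hamming_def
    by (intro Bochner_Integration.integral_cong refl sum.cong) (auto simp: indicator_def)
  also have "\<dots> = (\<Sum>j=1..d. M.prob (?E j))"
    by (subst Bochner_Integration.integral_sum)
      (auto intro!: integrable_real_indicator E simp: less_top[symmetric])
  also have "\<dots> \<le> (\<Sum>j=1..d. ?r)"
    by (intro sum_mono prob_E)
  finally show ?thesis
    by (simp add: \<tau>_def)
qed

section \<open>Growth of the normalisation and size of the exponent\<close>

text \<open>The bound \<open>4 ^ m \<le> 2 * sqrt m * C\<close> for the central binomial coefficient
  \<open>C\<close>, squared to avoid roots. The induction uses
  \<open>(m + 1) * C' = 2 * (2 * m + 1) * C\<close> for the next coefficient \<open>C'\<close>,
  together with \<open>4 * m * (m + 1) \<le> (2 * m + 1)\<^sup>2\<close>.\<close>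

lemma central_binomial_ge:
  assumes "m \<ge> 1"
  shows "16 ^ m \<le> (real ((2 * m) choose m))\<^sup>2 * (4 * real m)"
  using assms
proof (induction m rule: nat_induct_at_least)
  case (Suc m)
  define C C' where "C = real ((2 * m) choose m)" and "C' = real ((2 * Suc m) choose Suc m)"
  have "(2 * m + 1) choose m = (2 * m + 1) choose (m + 1)"
    by (subst binomial_symmetric) simp_all
  then have "(2 * Suc m) choose Suc m = 2 * ((2 * m + 1) choose (m + 1))"
    by simp
  then have "Suc m * ((2 * Suc m) choose Suc m) = 2 * (Suc (2 * m) * ((2 * m) choose m))"
    using Suc_times_binomial[of m "2 * m"] by (simp del: binomial_Suc_Suc mult_Suc mult_Suc_right)
  then have "real (Suc m * ((2 * Suc m) choose Suc m)) = real (2 * (Suc (2 * m) * ((2 * m) choose m)))"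
    by (rule arg_cong)
  then have C': "(real m + 1) * C' = 2 * (2 * real m + 1) * C"
    by (simp add: C_def C'_def del: binomial_Suc_Suc mult_Suc mult_Suc_right) (simp add: algebra_simps)
  have m: "real m \<ge> 1"
    using Suc.hyps by simp
  have "16 ^ Suc m * (real m * (real m + 1)) \<le> 16 ^ m * (4 * (2 * real m + 1)\<^sup>2)"
    by (simp add: power2_eq_square algebra_simps)
  also have "\<dots> \<le> C\<^sup>2 * (4 * real m) * (4 * (2 * real m + 1)\<^sup>2)"
    using Suc.IH by (intro mult_right_mono) (simp_all add: C_def)
  also have "\<dots> = (2 * (2 * real m + 1) * C)\<^sup>2 * (4 * real m)"
    by (simp only: power_mult_distrib) simp
  also have "\<dots> = C'\<^sup>2 * (4 * (real m + 1)) * (real m * (real m + 1))"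
    unfolding C'[symmetric] power_mult_distrib by (simp add: power2_eq_square)
  finally have "16 ^ Suc m \<le> C'\<^sup>2 * (4 * (real m + 1))"
    using m by (subst (asm) mult_le_cancel_right_pos) simp_all
  then show ?case
    by (simp add: C'_def add.commute)
qed simp

lemma two_power_double_squared: "(2 ^ (2 * m))\<^sup>2 = (16 :: real) ^ m"
  by (simp add: power_mult power2_eq_square flip: power_mult_distrib)

text \<open>For odd \<open>d\<close> this is the central binomial bound. For
  \<open>d = 2 * (k + 1)\<close> the coefficient next to the central one is
  \<open>k / (k + 1)\<close> times it, hence at least half of it; the loss of a factor
  \<open>4\<close> after squaring gives \<open>16 * k\<close>, the source of the constant
  \<open>8\<close>.\<close>

lemma K_squared_le:
  assumes "d \<ge> 3"
  shows "(K d)\<^sup>2 \<le> 8 * real d"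
proof (cases "odd d")
  case True
  then obtain m where d: "d = 2 * m + 1"
    by (auto elim!: oddE)
  have C: "real ((2 * m) choose m) > 0"
    by simp
  have "(K d)\<^sup>2 = 16 ^ m / (real ((2 * m) choose m))\<^sup>2"
    unfolding d K_odd power_divide two_power_double_squared ..
  also have "\<dots> \<le> 4 * real m"
    using central_binomial_ge[of m] assms C by (simp add: d divide_le_eq mult.commute)
  finally show ?thesis
    by (simp add: d)
next
  case False
  then obtain m where d: "d = 2 * m"
    by (auto elim!: evenE)
  then obtain k where m: "m = k + 1" and k: "k \<ge> 1"
    using assms by (metis Suc_eq_plus1 Suc_le_eq add_leE not0_implies_Suc numeral_3_eq_3 mult_0_right
        mult.right_neutral One_nat_def Suc_1 not_less_eq_eq le_zero_eq le_SucE)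
  define C where "C = real ((2 * k) choose k)"
  have C: "C > 0"
    by (simp add: C_def)
  have "Suc k * ((2 * k) choose Suc k) = k * ((2 * k) choose k)"
    using binomial_absorb_comp[of "2 * k" k] binomial_absorption[of k "2 * k"] by auto
  then have "real (Suc k * ((2 * k) choose Suc k)) = real (k * ((2 * k) choose k))"
    by (rule arg_cong)
  then have E: "(real k + 1) * real ((2 * k) choose Suc k) = real k * C"
    by (simp add: C_def algebra_simps)
  have "C / 2 \<le> real k * C / (real k + 1)"
    using k C by (simp add: field_simps)
  also have "\<dots> = real ((2 * k) choose Suc k)"
    using E by (simp add: field_simps)
  finally have le: "C / 2 \<le> real ((2 * k) choose Suc k)" .
  have "K d = 2 ^ (2 * k) / real ((2 * k) choose Suc k)"
    unfolding d using K_even[of m] m k by simp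
  also have "\<dots> \<le> 2 ^ (2 * k) / (C / 2)"
    using le C by (intro divide_left_mono mult_pos_pos zero_le_power) linarith+
  finally have "(K d)\<^sup>2 \<le> (2 ^ (2 * k) / (C / 2))\<^sup>2"
    using K_pos[OF assms] by (intro power_mono) simp_all
  also have "\<dots> = 4 * (16 ^ k / C\<^sup>2)"
    unfolding power_divide two_power_double_squared by simp
  also have "16 ^ k / C\<^sup>2 \<le> 4 * real k"
    using central_binomial_ge[OF k] C by (simp add: C_def divide_le_eq mult.commute)
  finally show ?thesis
    by (simp add: d m)
qed

lemma error_exponent_eq:
  "real n * (\<rho> * a / \<sigma>)\<^sup>2 / (2 * (B \<alpha> d)\<^sup>2)
    = real n * (exp \<alpha> - 1)\<^sup>2 * \<rho>\<^sup>2 * a\<^sup>2 / (2 * \<sigma>\<^sup>2 * (exp \<alpha> + 1)\<^sup>2 * (K d)\<^sup>2)"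
  by (simp add: B_def power_divide power_mult_distrib mult_ac)

text \<open>Uses \<open>exp \<alpha> - 1 \<ge> \<alpha>\<close>,
  \<open>exp \<alpha> + 1 \<le> 4\<close> and \<open>(K d)\<^sup>2 \<le> 8 * d\<close>; the constant
  is \<open>256 = 2 * 4\<^sup>2 * 8\<close>.\<close>

lemma error_exponent_ge:
  assumes "0 < \<alpha>" "\<alpha> \<le> 1" "d \<ge> 3" "\<sigma> > 0"
  shows "\<rho>\<^sup>2 / 256 * (real n * \<alpha>\<^sup>2 * a\<^sup>2 / (\<sigma>\<^sup>2 * real d))
    \<le> real n * (exp \<alpha> - 1)\<^sup>2 * \<rho>\<^sup>2 * a\<^sup>2 / (2 * \<sigma>\<^sup>2 * (exp \<alpha> + 1)\<^sup>2 * (K d)\<^sup>2)"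
proof -
  have "exp \<alpha> \<le> exp (1::real)" "exp (1::real) \<le> 3"
    using assms exp_le by simp_all
  then have e: "exp \<alpha> + 1 \<le> 4"
    by linarith
  have e1: "\<alpha> \<le> exp \<alpha> - 1"
    using exp_ge_add_one_self[of \<alpha>] by linarith
  have pos: "exp \<alpha> + 1 > 0"
    by (simp add: add_pos_pos)
  have "\<rho>\<^sup>2 / 256 * (real n * \<alpha>\<^sup>2 * a\<^sup>2 / (\<sigma>\<^sup>2 * real d))
      = real n * \<alpha>\<^sup>2 * \<rho>\<^sup>2 * a\<^sup>2 / (2 * \<sigma>\<^sup>2 * 4\<^sup>2 * (8 * real d))"
    by (simp add: field_simps)
  also have "\<dots> \<le> real n * (exp \<alpha> - 1)\<^sup>2 * \<rho>\<^sup>2 * a\<^sup>2 / (2 * \<sigma>\<^sup>2 * (exp \<alpha> + 1)\<^sup>2 * (K d)\<^sup>2)"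
  proof (rule frac_le)
    show "real n * \<alpha>\<^sup>2 * \<rho>\<^sup>2 * a\<^sup>2 \<le> real n * (exp \<alpha> - 1)\<^sup>2 * \<rho>\<^sup>2 * a\<^sup>2"
      using assms(1) e1 by (intro mult_right_mono mult_left_mono power_mono) auto
    show "0 < 2 * \<sigma>\<^sup>2 * (exp \<alpha> + 1)\<^sup>2 * (K d)\<^sup>2"
      using assms pos K_pos[OF assms(3)] by simp
    show "2 * \<sigma>\<^sup>2 * (exp \<alpha> + 1)\<^sup>2 * (K d)\<^sup>2 \<le> 2 * \<sigma>\<^sup>2 * 4\<^sup>2 * (8 * real d)"
      using e pos K_squared_le[OF assms(3)]
      by (intro mult_mono mult_left_mono power_mono) auto
  qed (intro mult_nonneg_nonneg; simp)
  finally show ?thesis .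
qed

section \<open>Passage to the limit\<close>

text \<open>Clears the denominator of the extended quotient. The form
  \<open>M * b d \<le> a d\<close> also covers the indices where \<open>b d = 0\<close>, for there
  it only says \<open>a d \<ge> 0\<close>.\<close>

lemma much_lessD:
  assumes "b \<lless> a" and pos: "\<forall>\<^sub>F d in sequentially. a d \<ge> 0 \<and> b d \<ge> 0"
  shows "\<forall>\<^sub>F d in sequentially. M * b d \<le> a d"
proof -
  have "\<forall>\<^sub>F d in sequentially. ereal M < ereal (a d) / ereal (b d)"
    using assms(1) unfolding much_less_def tendsto_PInfty by blast
  with pos show ?thesis
  proof eventually_elim
    case (elim d)
    show ?case
    proof (cases "b d = 0")
      case False
      with elim have "M < a d / b d" "b d > 0"
        by simp_all
      then show ?thesis
        by (simp add: field_simps)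
    qed (use elim in simp)
  qed
qed

text \<open>Half of \<open>\<kappa> * (q d)\<^sup>2\<close> eventually dominates \<open>L d\<close>,
  and the other half drives the exponential to zero.\<close>

lemma exp_diff_square_tendsto_0:
  fixes L q :: "nat \<Rightarrow> real"
  assumes "\<kappa> > 0" and q: "\<And>M. \<forall>\<^sub>F d in sequentially. M \<le> q d"
    and L: "\<And>M. \<forall>\<^sub>F d in sequentially. M * sqrt (L d) \<le> q d" "\<forall>\<^sub>F d in sequentially. L d \<ge> 0"
  shows "(\<lambda>d. exp (L d - \<kappa> * (q d)\<^sup>2)) \<longlonglongrightarrow> 0"
proof -
  have "filterlim q at_top sequentially"
    using q by (simp add: filterlim_at_top)
  then have "filterlim (\<lambda>d. \<kappa> / 2 * (q d)\<^sup>2) at_top sequentially"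
    using \<open>\<kappa> > 0\<close> by (intro filterlim_tendsto_pos_mult_at_top[OF tendsto_const] filterlim_pow_at_top) auto
  then have lim: "(\<lambda>d. exp (- (\<kappa> / 2 * (q d)\<^sup>2))) \<longlonglongrightarrow> 0"
    by (intro filterlim_compose[OF exp_at_bot] filterlim_uminus_at_bot_at_top[THEN filterlim_compose])
  \<comment> \<open>The choice \<open>M = sqrt (2 / \<kappa>)\<close> makes the domination of
    \<open>L d\<close> exact after squaring.\<close>
  have "\<forall>\<^sub>F d in sequentially. exp (L d - \<kappa> * (q d)\<^sup>2) \<le> exp (- (\<kappa> / 2 * (q d)\<^sup>2))"
    using L(1)[of "sqrt (2 / \<kappa>)"] L(2)
  proof eventually_elim
    case (elim d)
    then have "sqrt (2 / \<kappa> * L d) \<le> q d"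
      by (simp only: real_sqrt_mult)
    then have "2 / \<kappa> * L d \<le> (q d)\<^sup>2"
      by (rule sqrt_le_D)
    then have "L d \<le> \<kappa> / 2 * (q d)\<^sup>2"
      using \<open>\<kappa> > 0\<close> by (simp add: field_simps)
    then show ?case
      by simp
  qed
  from tendsto_sandwich[OF _ this tendsto_const lim] show ?thesis
    by simp
qed

text \<open>A supremum of reals is controlled only over a nonempty index set, and bounded from below
  by a member only if the values are bounded above. The zero vector, with empty support, supplies
  the member.\<close>

lemma SUP_Theta_plus_bounds:
  fixes f :: "(nat \<Rightarrow> real) \<Rightarrow> real"
  assumes "\<And>\<theta>. \<theta> \<in> Theta_plus d s a \<Longrightarrow> 0 \<le> f \<theta>" "\<And>\<theta>. \<theta> \<in> Theta_plus d s a \<Longrightarrow> f \<theta> \<le> u"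
  shows "0 \<le> (SUP \<theta> \<in> Theta_plus d s a. f \<theta>)" "(SUP \<theta> \<in> Theta_plus d s a. f \<theta>) \<le> u"
proof -
  have zero: "(\<lambda>j\<in>{1..d}. 0) \<in> Theta_plus d s a"
    unfolding Theta_plus_def by (auto intro!: exI[of _ "{}"])
  then show "(SUP \<theta> \<in> Theta_plus d s a. f \<theta>) \<le> u"
    using assms(2) by (intro cSUP_least) auto
  have "bdd_above (f ` Theta_plus d s a)"
    using assms(2) by (auto intro!: bdd_aboveI2)
  from order_trans[OF assms(1)[OF zero] cSUP_upper[OF zero this]]
  show "0 \<le> (SUP \<theta> \<in> Theta_plus d s a. f \<theta>)" .
qed

lemma expected_hamming_nonneg: "0 \<le> expected_hamming p \<sigma> \<alpha> n d \<tau> \<theta>"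
  unfolding expected_hamming_def hamming_def
  by (intro Bochner_Integration.integral_nonneg sum_nonneg) simp

theorem corollary3p5:
  fixes p :: "real \<Rightarrow> real" and c \<sigma> :: real
    and n s :: "nat \<Rightarrow> nat" and \<alpha> :: "nat \<Rightarrow> real"
  assumes "\<sigma> > 0"
    and "symmetric_strongly_log_concave c p"
    and "prob_space (noise_law p)"
    and "prob_space.variance (noise_law p) (\<lambda>x. x) = 1"
    and "\<And>d. d \<ge> 3 \<Longrightarrow> n d \<ge> 1"
    and "\<And>d. d \<ge> 3 \<Longrightarrow> \<alpha> d > 0"
    and "\<And>d. d \<ge> 3 \<Longrightarrow> 1 \<le> s d \<and> s d \<le> d"
    and "(\<lambda>d. \<alpha> d / real d) \<longlonglongrightarrow> 0"
    and "filterlim (\<lambda>d. real (n d) * (\<alpha> d)\<^sup>2 / real d) at_top sequentially"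
  shows
    "(\<forall>a :: nat \<Rightarrow> real.
        (\<forall>d\<ge>3. 0 < a d \<and> a d \<le> 2 * \<sigma>) \<and>
        (\<lambda>d. \<sigma> * sqrt (real d) / (\<alpha> d * sqrt (real (n d)))) \<lless> a \<longrightarrow>
        (\<forall>\<^sub>F d in sequentially.
          (SUP \<theta> \<in> Theta_plus d (s d) (a d).
             1 / real (s d) * expected_hamming p \<sigma> (\<alpha> d) (n d) d (p 2 * a d / \<sigma>) \<theta>)
          \<le> real d / real (s d) *
              exp (- (real (n d) * (exp (\<alpha> d) - 1)\<^sup>2 * (p 2)\<^sup>2 * (a d)\<^sup>2
                      / (2 * \<sigma>\<^sup>2 * (exp (\<alpha> d) + 1)\<^sup>2 * (K d)\<^sup>2)))))
     \<and>
     ((\<forall>d\<ge>3. \<alpha> d \<le> 1) \<and> (\<lambda>d. ln (real d)) \<lless> (\<lambda>d. real (n d) * (\<alpha> d)\<^sup>2 / real d) \<longrightarrow>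
       (\<forall>a :: nat \<Rightarrow> real.
          (\<forall>d\<ge>3. 0 < a d \<and> a d \<le> 2 * \<sigma>) \<and>
          (\<lambda>d. \<sigma> * sqrt (real d) / (\<alpha> d * sqrt (real (n d)))) \<lless> a \<and>
          (\<lambda>d. \<sigma> * sqrt (real d / (real (n d) * (\<alpha> d)\<^sup>2)) * sqrt (ln (real d / real (s d)))) \<lless> a \<longrightarrow>
          (\<lambda>d. SUP \<theta> \<in> Theta_plus d (s d) (a d).
             1 / real (s d) * expected_hamming p \<sigma> (\<alpha> d) (n d) d (p 2 * a d / \<sigma>) \<theta>)
          \<longlonglongrightarrow> 0)
       \<and>
       (\<forall>a :: nat \<Rightarrow> real.
          (\<forall>d\<ge>3. 0 < a d \<and> a d \<le> 2 * \<sigma>) \<and>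
          (\<lambda>d. \<sigma> * sqrt (real d / (real (n d) * (\<alpha> d)\<^sup>2)) * sqrt (ln (real d))) \<lless> a \<longrightarrow>
          (\<lambda>d. SUP \<theta> \<in> Theta_plus d (s d) (a d).
             expected_hamming p \<sigma> (\<alpha> d) (n d) d (p 2 * a d / \<sigma>) \<theta>)
          \<longlonglongrightarrow> 0))"
proof -
  let ?e = "\<lambda>a d. real (n d) * (exp (\<alpha> d) - 1)\<^sup>2 * (p 2)\<^sup>2 * (a d)\<^sup>2
                      / (2 * \<sigma>\<^sup>2 * (exp (\<alpha> d) + 1)\<^sup>2 * (K d)\<^sup>2)"
  let ?r = "\<lambda>d. \<sigma> * sqrt (real d / (real (n d) * (\<alpha> d)\<^sup>2))"
  let ?H = "\<lambda>a d \<theta>. expected_hamming p \<sigma> (\<alpha> d) (n d) d (p 2 * a d / \<sigma>) \<theta>"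
  have H: "?H a d \<theta> \<le> real d * exp (- ?e a d)"
    if "\<forall>d\<ge>3. 0 < a d \<and> a d \<le> 2 * \<sigma>" "d \<ge> 3" "\<theta> \<in> Theta_plus d (s d) (a d)" for a d \<theta>
    using expected_hamming_le[OF assms(2,3,1), of "\<alpha> d" d "n d" "a d" \<theta> "s d"] that assms(5,6)
    by (simp only: error_exponent_eq)
  have Hs: "1 / real (s d) * ?H a d \<theta> \<le> real d / real (s d) * exp (- ?e a d)"
    if "\<forall>d\<ge>3. 0 < a d \<and> a d \<le> 2 * \<sigma>" "d \<ge> 3" "\<theta> \<in> Theta_plus d (s d) (a d)" for a d \<theta>
    using mult_left_mono[OF H[OF that], of "1 / real (s d)"] by simp
  have s: "real (s d) \<ge> 1" "real (s d) \<le> real d" if "d \<ge> 3" for d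
    using assms(7)[OF that] by simp_all
  have r_pos: "?r d > 0" if "d \<ge> 3" for d
    using assms(1) assms(5,6)[OF that] that by (simp add: zero_less_mult_iff)
  have r_eq: "?r d = \<sigma> * sqrt (real d) / (\<alpha> d * sqrt (real (n d)))" if "d \<ge> 3" for d
    using assms(6)[OF that] by (simp add: real_sqrt_divide real_sqrt_mult mult.commute)
  have expo: "(p 2)\<^sup>2 / 256 * (a d / ?r d)\<^sup>2 \<le> ?e a d" if "d \<ge> 3" "\<alpha> d \<le> 1" for a d
  proof -
    have "(a d / ?r d)\<^sup>2 = real (n d) * (\<alpha> d)\<^sup>2 * (a d)\<^sup>2 / (\<sigma>\<^sup>2 * real d)"
      by (simp add: power_divide power_mult_distrib mult_ac)
    then show ?thesis
      using error_exponent_ge[OF assms(6)[OF that(1)] that(2,1) assms(1)] by simp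
  qed
  have \<kappa>: "(p 2)\<^sup>2 / 256 > 0"
    using strongly_log_concave_pos[OF assms(2), of 2] by simp
  \<comment> \<open>Signals are measured in units of the base rate \<open>?r d\<close>, so that a
    rate condition becomes a lower bound for \<open>a d / ?r d\<close>.\<close>
  have rate: "\<forall>\<^sub>F d in sequentially. M * sqrt (L d) \<le> a d / ?r d"
    if a: "\<forall>d\<ge>3. 0 < a d \<and> a d \<le> 2 * \<sigma>" and ml: "(\<lambda>d. ?r d * sqrt (L d)) \<lless> a"
      and L: "\<And>d. d \<ge> 3 \<Longrightarrow> L d \<ge> 0" for a L M
  proof -
    have "\<forall>\<^sub>F d in sequentially. 0 \<le> a d \<and> 0 \<le> ?r d * sqrt (L d)"
      using eventually_ge_at_top[of 3]
    proof eventually_elim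
      case (elim d)
      then have "0 \<le> a d" "0 \<le> ?r d" "0 \<le> sqrt (L d)"
        using a L r_pos by (simp_all add: less_imp_le)
      then show ?case
        by (intro conjI mult_nonneg_nonneg[of "?r d"])
    qed
    from much_lessD[OF ml this, of M] eventually_ge_at_top[of 3] show ?thesis
    proof eventually_elim
      case (elim d)
      then show ?case
        using r_pos[of d] by (simp add: pos_le_divide_eq mult_ac)
    qed
  qed
  have tail: "(\<lambda>d. exp (L d - (p 2)\<^sup>2 / 256 * (a d / ?r d)\<^sup>2)) \<longlonglongrightarrow> 0"
    if a: "\<forall>d\<ge>3. 0 < a d \<and> a d \<le> 2 * \<sigma>" and L: "\<And>d. d \<ge> 3 \<Longrightarrow> L d \<ge> 0"
      and ml: "(\<lambda>d. ?r d * sqrt (L d)) \<lless> a" "\<And>M. \<forall>\<^sub>F d in sequentially. M \<le> a d / ?r d" for a L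
    using rate[OF a ml(1) L] L
    by (intro exp_diff_square_tendsto_0 \<kappa> ml(2)) (auto intro: eventually_sequentiallyI[of 3])
  \<comment> \<open>One argument serves both limits, with weight \<open>1 / s d\<close> or
    \<open>1\<close>. The prefactor \<open>w d * d\<close> enters the exponent as its logarithm,
    which \<open>1 \<le> w d * d\<close> makes nonnegative.\<close>
  have dominated: "(\<lambda>d. SUP \<theta> \<in> Theta_plus d (s d) (a d). w d * ?H a d \<theta>) \<longlonglongrightarrow> 0"
    if a: "\<forall>d\<ge>3. 0 < a d \<and> a d \<le> 2 * \<sigma>" and \<alpha>: "\<forall>d\<ge>3. \<alpha> d \<le> 1"
      and w: "\<And>d. d \<ge> 3 \<Longrightarrow> 0 < w d \<and> 1 \<le> w d * real d"
      and ml: "(\<lambda>d. ?r d * sqrt (ln (w d * real d))) \<lless> a" "\<And>M. \<forall>\<^sub>F d in sequentially. M \<le> a d / ?r d"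
    for a w
  proof -
    let ?u = "\<lambda>d. exp (ln (w d * real d) - (p 2)\<^sup>2 / 256 * (a d / ?r d)\<^sup>2)"
    have u: "w d * ?H a d \<theta> \<le> ?u d" if d: "d \<ge> 3" and \<theta>: "\<theta> \<in> Theta_plus d (s d) (a d)" for d \<theta>
    proof -
      have "w d * ?H a d \<theta> \<le> w d * (real d * exp (- ?e a d))"
        using H[OF a d \<theta>] w[OF d] by (intro mult_left_mono) auto
      also have "\<dots> = w d * real d * exp (- ?e a d)"
        by simp
      also have "\<dots> \<le> w d * real d * exp (- ((p 2)\<^sup>2 / 256 * (a d / ?r d)\<^sup>2))"
        using expo[of d a] d \<alpha> w[OF d] by (intro mult_left_mono) auto
      also have "\<dots> = ?u d"
        using w[OF d] d by (simp add: exp_diff exp_minus field_simps)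
      finally show ?thesis .
    qed
    have nonneg: "0 \<le> w d * ?H a d \<theta>" if "d \<ge> 3" for d \<theta>
      using w[OF that] expected_hamming_nonneg by (intro mult_nonneg_nonneg) auto
    have lim: "?u \<longlonglongrightarrow> 0"
      using w by (intro tail a ml) simp
    have "0 \<le> (SUP \<theta> \<in> Theta_plus d (s d) (a d). w d * ?H a d \<theta>)
        \<and> (SUP \<theta> \<in> Theta_plus d (s d) (a d). w d * ?H a d \<theta>) \<le> ?u d" if "d \<ge> 3" for d
      by (intro conjI SUP_Theta_plus_bounds[OF nonneg[OF that] u[OF that]])
    then show ?thesis
      by (intro tendsto_sandwich[OF _ _ tendsto_const lim] eventually_sequentiallyI[of 3]) blast+
  qed
  show ?thesis
  proof (intro conjI allI impI; (elim conjE)?)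
    fix a :: "nat \<Rightarrow> real" assume a: "\<forall>d\<ge>3. 0 < a d \<and> a d \<le> 2 * \<sigma>"
    show "\<forall>\<^sub>F d in sequentially.
        (SUP \<theta> \<in> Theta_plus d (s d) (a d). 1 / real (s d) * ?H a d \<theta>)
          \<le> real d / real (s d) * exp (- ?e a d)"
      using Hs[OF a] by (intro eventually_sequentiallyI[of 3] SUP_Theta_plus_bounds(2)) (simp_all add: expected_hamming_nonneg)
  next
    fix a :: "nat \<Rightarrow> real" assume a: "\<forall>d\<ge>3. 0 < a d \<and> a d \<le> 2 * \<sigma>" and \<alpha>: "\<forall>d\<ge>3. \<alpha> d \<le> 1"
      and ml: "(\<lambda>d. \<sigma> * sqrt (real d) / (\<alpha> d * sqrt (real (n d)))) \<lless> a"
        "(\<lambda>d. ?r d * sqrt (ln (real d / real (s d)))) \<lless> a"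
    \<comment> \<open>When \<open>s d = d\<close> the logarithmic rate vanishes and forces no
      growth, so divergence of \<open>a d / ?r d\<close> is taken from the base rate.\<close>
    have q: "\<forall>\<^sub>F d in sequentially. M \<le> a d / ?r d" for M
    proof -
      have "\<forall>\<^sub>F d in sequentially. 0 \<le> a d \<and> 0 \<le> \<sigma> * sqrt (real d) / (\<alpha> d * sqrt (real (n d)))"
        using a r_pos r_eq by (intro eventually_sequentiallyI[of 3]) (metis less_imp_le)
      from much_lessD[OF ml(1) this, of M] eventually_ge_at_top[of 3] show ?thesis
      proof eventually_elim
        case (elim d)
        then have "M * ?r d \<le> a d"
          using r_eq by metis
        with r_pos[of d] elim(2) show ?case
          by (simp only: pos_le_divide_eq)
      qed
    qed
    show "(\<lambda>d. SUP \<theta> \<in> Theta_plus d (s d) (a d). 1 / real (s d) * ?H a d \<theta>) \<longlonglongrightarrow> 0"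
    proof (rule dominated[OF a \<alpha> _ _ q])
      show "0 < 1 / real (s d) \<and> 1 \<le> 1 / real (s d) * real d" if "d \<ge> 3" for d
        using s[OF that] by (simp add: field_simps)
    qed (use ml(2) in simp)
  next
    fix a :: "nat \<Rightarrow> real" assume a: "\<forall>d\<ge>3. 0 < a d \<and> a d \<le> 2 * \<sigma>" and \<alpha>: "\<forall>d\<ge>3. \<alpha> d \<le> 1"
      and ml: "(\<lambda>d. ?r d * sqrt (ln (real d))) \<lless> a"
    \<comment> \<open>Here the logarithmic factor itself diverges, so the single rate condition also
      yields divergence of \<open>a d / ?r d\<close>.\<close>
    have "filterlim (\<lambda>d. sqrt (ln (real d))) at_top sequentially"
      by (intro filterlim_compose[OF sqrt_at_top] filterlim_compose[OF ln_at_top] filterlim_real_sequentially)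
    then have "\<forall>\<^sub>F d in sequentially. M \<le> sqrt (ln (real d))" for M
      by (simp add: filterlim_at_top)
    moreover have "\<forall>\<^sub>F d in sequentially. sqrt (ln (real d)) \<le> a d / ?r d"
      using rate[OF a ml, of 1] by simp
    ultimately have q: "\<forall>\<^sub>F d in sequentially. M \<le> a d / ?r d" for M
      by (rule eventually_elim2) (rule order_trans)
    show "(\<lambda>d. SUP \<theta> \<in> Theta_plus d (s d) (a d). ?H a d \<theta>) \<longlonglongrightarrow> 0"
      using dominated[OF a \<alpha> _ _ q, of "\<lambda>_. 1"] ml by simp
  qed
qed

end
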